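(* Let $k\in\mathbb N$ and let $f\colon([\mathbb N]^k,d_H)\to T^*$ be a Lipschitz map. Then there exists an infinite subset $\mathbb M\subset\mathbb N$ such that for all $\bar m,\bar n\in[\mathbb M]^k$, $$\|f(\bar m)-f(\bar n)\|\le 5\,\mathrm{Lip}(f).$$
   Context: $\mathbb N=\{1,2,\dots\}$. For $\mathbb M\subset\mathbb N$ infinite, $[\mathbb M]^k$ is the set of subsets of $\mathbb M$ of cardinality $k$, whose elements are listed in increasing order: $\bar m=\{m_1<\dots<m_k\}$. The Hamming metric on $[\mathbb N]^k$ is $d_H(\bar m,\bar n)=|\{i\in\{1,\dots,k\}: m_i\ne n_i\}|$. $\mathrm{Lip}(f)$ is the (least) Lipschitz constant of $f$. **Tsirelson's space.** $c_{00}$ is the space of finitely supported real sequences, with unit vectors $(e_i)_{i\ge1}$. For finite sets $E,F\subset\mathbb N$ write $E<F$ if $\max E<\min F$, and $n\le E$ if $n\le\min E$. A finite sequence $(E_j)_{j=1}^n$ of nonempty finite subsets of $\mathbb N$ is admissible if $n\le E_1<E_2<\dots<E_n$. For $x=\sum_j\xi_je_j\in c_{00}$ let $E(x)=\sum_{j\in E}\xi_je_j$. Define norms on $c_{00}$ by $\|x\|_0=\max_j|\xi_j|$ and, for $k\ge1$, $\|x\|_k=\max\big(\|x\|_{k-1},\tfrac12\max\{\sum_{j=1}^n\|E_j(x)\|_{k-1}: (E_j)_{j=1}^n\text{ admissible}\}\big)$, and $\|x\|=\lim_k\|x\|_k$. $T$ is the completion of $(c_{00},\|\cdot\|)$ and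 $T^*$ (Tsirelson's original space) is its dual, with the dual norm. *)

theory Defs
  imports "HOL-Analysis.Analysis" "HOL-Library.Ramsey"
begin

definition cauchy_eq :: "(nat \<Rightarrow> 'a::real_normed_vector) \<Rightarrow> (nat \<Rightarrow> 'a) \<Rightarrow> bool" where
  "cauchy_eq X Y \<longleftrightarrow> Cauchy X \<and> Cauchy Y \<and> (\<lambda>n. X n - Y n) \<longlonglongrightarrow> 0"

lemma part_equivp_cauchy_eq: "part_equivp cauchy_eq"
proof (rule part_equivpI)
  show "\<exists>X::nat \<Rightarrow> 'a. cauchy_eq X X"
    by (rule exI[of _ "\<lambda>_. 0"]) (simp add: cauchy_eq_def LIMSEQ_imp_Cauchy[OF tendsto_const])
  show "symp (cauchy_eq :: (nat \<Rightarrow> 'a) \<Rightarrow> _)"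
  proof (rule sympI)
    fix X Y :: "nat \<Rightarrow> 'a"
    assume "cauchy_eq X Y"
    then show "cauchy_eq Y X"
      unfolding cauchy_eq_def using tendsto_minus[of "\<lambda>n. X n - Y n" 0 sequentially] by simp
  qed
  show "transp (cauchy_eq :: (nat \<Rightarrow> 'a) \<Rightarrow> _)"
  proof (rule transpI)
    fix X Y Z :: "nat \<Rightarrow> 'a"
    assume "cauchy_eq X Y" "cauchy_eq Y Z"
    then show "cauchy_eq X Z"
      unfolding cauchy_eq_def
      using tendsto_add[of "\<lambda>n. X n - Y n" 0 sequentially "\<lambda>n. Y n - Z n" 0] by simp
  qed
qed

quotient_type (overloaded) 'a ncompletion = "nat \<Rightarrow> 'a::real_normed_vector" / partial: cauchy_eq
  by (rule part_equivp_cauchy_eq)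

lemma Cauchy_const': "Cauchy (\<lambda>_. c :: 'a::real_normed_vector)"
  by (rule LIMSEQ_imp_Cauchy[OF tendsto_const])

lemma Cauchy_scaleR':
  fixes X :: "nat \<Rightarrow> 'a::real_normed_vector"
  assumes "Cauchy X" shows "Cauchy (\<lambda>n. r *\<^sub>R X n)"
  by (rule bounded_linear.Cauchy[OF bounded_linear_scaleR_right assms])

lemma Cauchy_add':
  fixes X Y :: "nat \<Rightarrow> 'a::real_normed_vector"
  assumes "Cauchy X" "Cauchy Y" shows "Cauchy (\<lambda>n. X n + Y n)"
proof (rule metric_CauchyI)
  fix e :: real assume "e > 0"
  then have e: "e / 2 > 0" by simp
  obtain M where M: "\<forall>m\<ge>M. \<forall>n\<ge>M. dist (X m) (X n) < e / 2"
    using metric_CauchyD[OF assms(1) e] by blast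
  obtain N where N: "\<forall>m\<ge>N. \<forall>n\<ge>N. dist (Y m) (Y n) < e / 2"
    using metric_CauchyD[OF assms(2) e] by blast
  have "dist (X m + Y m) (X n + Y n) < e" if "m \<ge> max M N" "n \<ge> max M N" for m n
  proof -
    have "dist (X m + Y m) (X n + Y n) \<le> dist (X m) (X n) + dist (Y m) (Y n)"
      by (rule dist_triangle_add)
    also have "\<dots> < e / 2 + e / 2" using M N that by (intro add_strict_mono) auto
    finally show ?thesis by simp
  qed
  then show "\<exists>N. \<forall>m\<ge>N. \<forall>n\<ge>N. dist (X m + Y m) (X n + Y n) < e" by blast
qed

lemma Cauchy_diff':
  fixes X Y :: "nat \<Rightarrow> 'a::real_normed_vector"
  assumes "Cauchy X" "Cauchy Y" shows "Cauchy (\<lambda>n. X n - Y n)"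
  using Cauchy_add'[OF assms(1) Cauchy_scaleR'[OF assms(2), of "-1"]] by simp

lemma Cauchy_norm':
  fixes X :: "nat \<Rightarrow> 'a::real_normed_vector"
  assumes "Cauchy X" shows "convergent (\<lambda>n. norm (X n))"
proof -
  have "Cauchy (\<lambda>n. norm (X n))"
  proof (rule metric_CauchyI)
    fix e :: real assume "e > 0"
    then obtain N where "\<forall>m\<ge>N. \<forall>n\<ge>N. dist (X m) (X n) < e"
      using metric_CauchyD[OF assms] by blast
    then show "\<exists>N. \<forall>m\<ge>N. \<forall>n\<ge>N. dist (norm (X m)) (norm (X n)) < e"
      unfolding dist_norm real_norm_def
      using norm_triangle_ineq3 by (blast intro: le_less_trans)
  qed
  then show ?thesis by (simp add: Cauchy_convergent_iff)
qed

instantiation ncompletion :: (real_normed_vector) real_normed_vector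
begin

lift_definition zero_ncompletion :: "'a ncompletion" is "\<lambda>_. 0"
  by (simp add: cauchy_eq_def Cauchy_const')

lift_definition plus_ncompletion :: "'a ncompletion \<Rightarrow> 'a ncompletion \<Rightarrow> 'a ncompletion"
  is "\<lambda>X Y n. X n + Y n"
proof -
  fix X X' Y Y' :: "nat \<Rightarrow> 'a" assume a: "cauchy_eq X X'" "cauchy_eq Y Y'"
  then have "(\<lambda>n. (X n - X' n) + (Y n - Y' n)) \<longlonglongrightarrow> 0 + 0"
    unfolding cauchy_eq_def by (intro tendsto_add) auto
  with a show "cauchy_eq (\<lambda>n. X n + Y n) (\<lambda>n. X' n + Y' n)"
    by (simp add: cauchy_eq_def Cauchy_add' algebra_simps)
qed

lift_definition uminus_ncompletion :: "'a ncompletion \<Rightarrow> 'a ncompletion"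
  is "\<lambda>X n. - X n"
proof -
  fix X Y :: "nat \<Rightarrow> 'a" assume a: "cauchy_eq X Y"
  then have "(\<lambda>n. - (X n - Y n)) \<longlonglongrightarrow> - 0"
    unfolding cauchy_eq_def by (intro tendsto_minus) auto
  with a show "cauchy_eq (\<lambda>n. - X n) (\<lambda>n. - Y n)"
    using Cauchy_scaleR'[of X "-1"] Cauchy_scaleR'[of Y "-1"]
    by (simp add: cauchy_eq_def)
qed

lift_definition minus_ncompletion :: "'a ncompletion \<Rightarrow> 'a ncompletion \<Rightarrow> 'a ncompletion"
  is "\<lambda>X Y n. X n - Y n"
proof -
  fix X X' Y Y' :: "nat \<Rightarrow> 'a" assume a: "cauchy_eq X X'" "cauchy_eq Y Y'"
  then have "(\<lambda>n. (X n - X' n) - (Y n - Y' n)) \<longlonglongrightarrow> 0 - 0"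
    unfolding cauchy_eq_def by (intro tendsto_diff) auto
  with a show "cauchy_eq (\<lambda>n. X n - Y n) (\<lambda>n. X' n - Y' n)"
    by (simp add: cauchy_eq_def Cauchy_diff' algebra_simps)
qed

lift_definition scaleR_ncompletion :: "real \<Rightarrow> 'a ncompletion \<Rightarrow> 'a ncompletion"
  is "\<lambda>r X n. r *\<^sub>R X n"
proof -
  fix r and X Y :: "nat \<Rightarrow> 'a" assume a: "cauchy_eq X Y"
  then have "(\<lambda>n. r *\<^sub>R (X n - Y n)) \<longlonglongrightarrow> r *\<^sub>R 0"
    unfolding cauchy_eq_def by (intro tendsto_scaleR tendsto_const) auto
  with a show "cauchy_eq (\<lambda>n. r *\<^sub>R X n) (\<lambda>n. r *\<^sub>R Y n)"
    by (simp add: cauchy_eq_def Cauchy_scaleR' scaleR_diff_right)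
qed

lift_definition norm_ncompletion :: "'a ncompletion \<Rightarrow> real"
  is "\<lambda>X. lim (\<lambda>n. norm (X n))"
proof -
  fix X Y :: "nat \<Rightarrow> 'a" assume a: "cauchy_eq X Y"
  then obtain l where l: "(\<lambda>n. norm (X n)) \<longlonglongrightarrow> l"
    using Cauchy_norm'[of X] by (auto simp: cauchy_eq_def convergent_def)
  have z: "(\<lambda>n. norm (X n - Y n)) \<longlonglongrightarrow> 0"
    using a unfolding cauchy_eq_def by (simp add: tendsto_norm_zero)
  have "(\<lambda>n. norm (X n) - norm (Y n)) \<longlonglongrightarrow> 0"
    by (rule Lim_null_comparison[OF _ z]) (simp add: norm_triangle_ineq3)
  from tendsto_diff[OF l this] have "(\<lambda>n. norm (Y n)) \<longlonglongrightarrow> l" by simp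
  with l show "lim (\<lambda>n. norm (X n)) = lim (\<lambda>n. norm (Y n))"
    by (simp add: limI)
qed

definition dist_ncompletion :: "'a ncompletion \<Rightarrow> 'a ncompletion \<Rightarrow> real" where
  "dist_ncompletion x y = norm (x - y)"

definition sgn_ncompletion :: "'a ncompletion \<Rightarrow> 'a ncompletion" where
  "sgn_ncompletion x = scaleR (inverse (norm x)) x"

definition uniformity_ncompletion :: "('a ncompletion \<times> 'a ncompletion) filter" where
  "uniformity_ncompletion = (INF e\<in>{0<..}. principal {(x, y). dist x y < e})"

definition open_ncompletion :: "'a ncompletion set \<Rightarrow> bool" where
  "open_ncompletion U \<longleftrightarrow> (\<forall>x\<in>U. \<forall>\<^sub>F (x', y) in uniformity. x' = x \<longrightarrow> y \<in> U)"

instance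
proof
  fix x y z :: "'a ncompletion" and a b :: real and U :: "'a ncompletion set"
  have refl0: "cauchy_eq X Y" if "Cauchy X" "Cauchy Y" "X = Y" for X Y :: "nat \<Rightarrow> 'a"
    using that by (simp add: cauchy_eq_def)
  have lims: "(\<lambda>n. norm (X n)) \<longlonglongrightarrow> lim (\<lambda>n. norm (X n))" if "Cauchy X" for X :: "nat \<Rightarrow> 'a"
    using Cauchy_norm'[OF that] by (simp add: convergent_LIMSEQ_iff)
  show "x + y + z = x + (y + z)"
    by transfer (rule refl0; simp add: cauchy_eq_def Cauchy_add' add.assoc)
  show "x + y = y + x"
    by transfer (rule refl0[OF _ _ ext[OF add.commute]]; simp add: cauchy_eq_def Cauchy_add')
  show "0 + x = x"
    by transfer (rule refl0; simp add: cauchy_eq_def)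
  show "- x + x = 0"
    by transfer (rule refl0; simp add: cauchy_eq_def Cauchy_const')
  show "x - y = x + - y"
    by transfer (rule refl0; simp add: cauchy_eq_def Cauchy_diff')
  show "a *\<^sub>R (x + y) = a *\<^sub>R x + a *\<^sub>R y"
    by transfer (rule refl0; simp add: cauchy_eq_def Cauchy_add' Cauchy_scaleR' scaleR_add_right)
  show "(a + b) *\<^sub>R x = a *\<^sub>R x + b *\<^sub>R x"
    by transfer (rule refl0; simp add: cauchy_eq_def Cauchy_add' Cauchy_scaleR' scaleR_add_left)
  show "a *\<^sub>R b *\<^sub>R x = (a * b) *\<^sub>R x"
    by transfer (rule refl0; simp add: cauchy_eq_def Cauchy_scaleR')
  show "1 *\<^sub>R x = x"
    by transfer (rule refl0; simp add: cauchy_eq_def)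
  show "dist x y = norm (x - y)" by (rule dist_ncompletion_def)
  show "sgn x = scaleR (inverse (norm x)) x" by (rule sgn_ncompletion_def)
  show "uniformity = (INF e\<in>{0<..}. principal {(x :: 'a ncompletion, y). dist x y < e})"
    by (rule uniformity_ncompletion_def)
  show "open U \<longleftrightarrow> (\<forall>x\<in>U. \<forall>\<^sub>F (x', y) in uniformity. x' = x \<longrightarrow> y \<in> U)"
    by (rule open_ncompletion_def)
  show "norm x = 0 \<longleftrightarrow> x = 0"
  proof transfer
    fix X :: "nat \<Rightarrow> 'a" assume "cauchy_eq X X"
    then have c: "Cauchy X" by (simp add: cauchy_eq_def)
    have "lim (\<lambda>n. norm (X n)) = 0 \<longleftrightarrow> (\<lambda>n. norm (X n)) \<longlonglongrightarrow> 0"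
    proof
      assume "lim (\<lambda>n. norm (X n)) = 0"
      with lims[OF c] show "(\<lambda>n. norm (X n)) \<longlonglongrightarrow> 0" by simp
    qed (rule limI)
    then show "lim (\<lambda>n. norm (X n)) = 0 \<longleftrightarrow> cauchy_eq X (\<lambda>_. 0)"
      using c by (simp add: cauchy_eq_def Cauchy_const' tendsto_norm_zero_iff)
  qed
  show "norm (x + y) \<le> norm x + norm y"
  proof transfer
    fix X Y :: "nat \<Rightarrow> 'a" assume "cauchy_eq X X" "cauchy_eq Y Y"
    then have c: "Cauchy X" "Cauchy Y" by (simp_all add: cauchy_eq_def)
    show "lim (\<lambda>n. norm (X n + Y n)) \<le> lim (\<lambda>n. norm (X n)) + lim (\<lambda>n. norm (Y n))"
      by (rule LIMSEQ_le[OF lims[OF Cauchy_add'[OF c]] tendsto_add[OF lims[OF c(1)] lims[OF c(2)]]])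
        (simp add: norm_triangle_ineq)
  qed
  show "norm (a *\<^sub>R x) = \<bar>a\<bar> * norm x"
  proof transfer
    fix a and X :: "nat \<Rightarrow> 'a" assume "cauchy_eq X X"
    then have c: "Cauchy X" by (simp_all add: cauchy_eq_def)
    show "lim (\<lambda>n. norm (a *\<^sub>R X n)) = \<bar>a\<bar> * lim (\<lambda>n. norm (X n))"
      using limI[OF tendsto_mult[OF tendsto_const lims[OF c], of "\<bar>a\<bar>"]] by simp
  qed
qed

end

lift_definition ncompletion_of :: "'a::real_normed_vector \<Rightarrow> 'a ncompletion" is "\<lambda>x _. x"
  by (simp add: cauchy_eq_def Cauchy_const')

lemma ncompletion_of_linear: "linear ncompletion_of"
  by (rule linearI; transfer; simp add: cauchy_eq_def Cauchy_const')

lemma norm_ncompletion_of [simp]: "norm (ncompletion_of x) = norm x"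
  by transfer simp

lemma ncompletion_of_diff: "ncompletion_of (x - y) = ncompletion_of x - ncompletion_of y"
  by (rule linear_diff[OF ncompletion_of_linear])

lemma ncompletion_approx:
  fixes X :: "nat \<Rightarrow> 'a::real_normed_vector"
  assumes "Cauchy X"
  shows "(\<lambda>n. ncompletion_of (X n)) \<longlonglongrightarrow> abs_ncompletion X"
proof (rule metric_LIMSEQ_I)
  fix e :: real assume "e > 0"
  then obtain N where N: "\<forall>m\<ge>N. \<forall>n\<ge>N. dist (X m) (X n) < e / 2"
    using metric_CauchyD[OF assms, of "e/2"] by auto
  have "dist (ncompletion_of (X n)) (abs_ncompletion X) < e" if "n \<ge> N" for n
  proof -
    have eq: "cauchy_eq X X" "cauchy_eq (\<lambda>_. X n) (\<lambda>_. X n)"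
      using assms by (simp_all add: cauchy_eq_def Cauchy_const')
    have d: "Cauchy (\<lambda>m. X n - X m)"
      by (intro Cauchy_diff' Cauchy_const' assms)
    have "dist (ncompletion_of (X n)) (abs_ncompletion X) = lim (\<lambda>m. norm (X n - X m))"
      using eq d
      by (simp add: dist_norm ncompletion_of.abs_eq minus_ncompletion.abs_eq norm_ncompletion.abs_eq cauchy_eq_def)
    also have "\<dots> \<le> e / 2"
    proof (rule LIMSEQ_le_const2)
      show "(\<lambda>m. norm (X n - X m)) \<longlonglongrightarrow> lim (\<lambda>m. norm (X n - X m))"
        using Cauchy_norm'[OF d] by (simp add: convergent_LIMSEQ_iff)
      show "\<exists>N'. \<forall>m\<ge>N'. norm (X n - X m) \<le> e / 2"
        using N that by (metis dist_norm less_imp_le)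
    qed
    finally show ?thesis using \<open>e > 0\<close> by simp
  qed
  then show "\<exists>N. \<forall>n\<ge>N. dist (ncompletion_of (X n)) (abs_ncompletion X) < e" by blast
qed

lemma ncompletion_dense: "closure (range ncompletion_of) = (UNIV :: 'a::real_normed_vector ncompletion set)"
proof -
  have "x \<in> closure (range ncompletion_of)" for x :: "'a ncompletion"
  proof (induction x rule: ncompletion.abs_induct)
    case (1 X)
    then have "Cauchy X" by (simp add: cauchy_eq_def)
    from ncompletion_approx[OF this] show ?case
      unfolding closure_sequential by (intro exI[of _ "\<lambda>n. ncompletion_of (X n)"]) simp
  qed
  then show ?thesis by blast
qed

instance ncompletion :: (real_normed_vector) banach
proof
  fix F :: "nat \<Rightarrow> 'a ncompletion" assume F: "Cauchy F"
  have "\<exists>y. dist (ncompletion_of y) (F n) < inverse (real (Suc n))" for n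
  proof -
    have "F n \<in> closure (range ncompletion_of)" by (simp add: ncompletion_dense)
    then show ?thesis unfolding closure_approachable by auto
  qed
  then obtain y where y: "\<And>n. dist (ncompletion_of (y n)) (F n) < inverse (real (Suc n))"
    by metis
  have z: "(\<lambda>n. ncompletion_of (y n) - F n) \<longlonglongrightarrow> 0"
    by (rule Lim_null_comparison[OF _ LIMSEQ_inverse_real_of_nat])
      (use y in \<open>simp add: dist_norm less_imp_le\<close>)
  have "Cauchy (\<lambda>n. ncompletion_of (y n) - F n + F n)"
    by (rule Cauchy_add'[OF LIMSEQ_imp_Cauchy[OF z] F])
  then have "Cauchy (\<lambda>n. ncompletion_of (y n))" by simp
  moreover have "dist (ncompletion_of (y m)) (ncompletion_of (y n)) = dist (y m) (y n)" for m n
    by (simp only: dist_norm norm_ncompletion_of ncompletion_of_diff[symmetric])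
  ultimately have "Cauchy y" unfolding Cauchy_def by simp
  from tendsto_diff[OF ncompletion_approx[OF this] z]
  have "F \<longlonglongrightarrow> abs_ncompletion y" by simp
  then show "convergent F" by (rule convergentI)
qed

text \<open>Sequences are functions on \<^typ>\<open>nat\<close>; as the unit vectors are $e_1, e_2, \dots$, the
  coordinate \<open>0\<close> is required to vanish.\<close>

typedef c00 = "{x :: nat \<Rightarrow> real. x 0 = 0 \<and> finite {j. x j \<noteq> 0}}"
  morphisms coord Abs_c00
  by (rule exI[of _ "\<lambda>_. 0"]) simp

setup_lifting type_definition_c00

definition restr :: "nat set \<Rightarrow> (nat \<Rightarrow> real) \<Rightarrow> nat \<Rightarrow> real" where
  "restr E x = (\<lambda>j. if j \<in> E then x j else 0)"

text \<open>Admissibility forces \<open>E \<subseteq> {1..}\<close> for all members, since the length is at least \<open>1\<close>.\<close>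

definition admissible :: "nat set list \<Rightarrow> bool" where
  "admissible Es \<longleftrightarrow> Es \<noteq> [] \<and> (\<forall>E\<in>set Es. finite E \<and> E \<noteq> {}) \<and>
     length Es \<le> Min (hd Es) \<and> sorted_wrt (\<lambda>E F. Max E < Min F) Es"

text \<open>The levels are defined on all functions but are meaningful only for finitely supported
  ones, where both maxima are over finite nonempty sets (\<open>finite_range_abs\<close>,
  \<open>finite_tsum\<close> and \<open>tsum_nonempty\<close> below).\<close>

primrec tnorm_level :: "nat \<Rightarrow> (nat \<Rightarrow> real) \<Rightarrow> real" where
  "tnorm_level 0 x = Max (range (\<lambda>j. \<bar>x j\<bar>))"
| "tnorm_level (Suc k) x =
     max (tnorm_level k x)
         (1/2 * Max {(\<Sum>E\<leftarrow>Es. tnorm_level k (restr E x)) | Es. admissible Es})"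

definition tnorm :: "(nat \<Rightarrow> real) \<Rightarrow> real" where
  "tnorm x = lim (\<lambda>k. tnorm_level k x)"

abbreviation fsupp :: "(nat \<Rightarrow> real) \<Rightarrow> bool" where
  "fsupp x \<equiv> finite {j. x j \<noteq> 0}"

abbreviation tsum :: "nat \<Rightarrow> (nat \<Rightarrow> real) \<Rightarrow> real set" where
  "tsum k x \<equiv> {(\<Sum>E\<leftarrow>Es. tnorm_level k (restr E x)) | Es. admissible Es}"

lemma finite_range_abs: "fsupp x \<Longrightarrow> finite (range (\<lambda>j. \<bar>x j\<bar>))"
proof -
  assume "fsupp x"
  moreover have "range (\<lambda>j. \<bar>x j\<bar>) \<subseteq> insert 0 ((\<lambda>j. \<bar>x j\<bar>) ` {j. x j \<noteq> 0})" by auto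
  ultimately show ?thesis by (meson finite_imageI finite_insert finite_subset)
qed

lemma admissible_singleton: "admissible [{1}]"
  by (simp add: admissible_def)

lemma tsum_nonempty: "tsum k x \<noteq> {}"
  using admissible_singleton by blast

lemma fsupp_restr: "fsupp x \<Longrightarrow> fsupp (restr E x)"
  by (erule rev_finite_subset) (auto simp: restr_def)

lemma tnorm_level_zero: "tnorm_level k (\<lambda>_. 0) = 0"
proof (induction k)
  case (Suc k)
  have "restr E (\<lambda>_. 0) = (\<lambda>_. 0)" for E by (simp add: restr_def fun_eq_iff)
  then have "tsum k (\<lambda>_. 0) = {0}" using Suc admissible_singleton by auto
  then show ?case using Suc by simp
qed simp

lemma finite_tsum:
  assumes "fsupp x"
  shows "finite (tsum k x)"
proof -
  let ?S = "{j. x j \<noteq> 0}"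
  let ?g = "\<lambda>E. tnorm_level k (restr E x)"
  have "tsum k x \<subseteq> (\<lambda>xs. \<Sum>E\<leftarrow>xs. ?g E) ` {xs. set xs \<subseteq> Pow ?S \<and> distinct xs}"
  proof clarify
    fix Es assume adm: "admissible Es"
    define xs where "xs = filter (\<lambda>E. E \<noteq> {}) (map (\<lambda>E. E \<inter> ?S) Es)"
    have g: "?g (E \<inter> ?S) = ?g E" for E
      by (rule arg_cong[of _ _ "tnorm_level k"]) (auto simp: restr_def fun_eq_iff)
    have g0: "?g {} = 0"
      using tnorm_level_zero[of k] by (simp add: restr_def)
    have flt: "(\<Sum>E\<leftarrow>filter (\<lambda>E. E \<noteq> {}) ys. ?g E) = (\<Sum>E\<leftarrow>ys. ?g E)" for ys
      by (induction ys) (use g0 in auto)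
    have "(\<Sum>E\<leftarrow>xs. ?g E) = (\<Sum>E\<leftarrow>Es. ?g E)"
      unfolding xs_def flt by (simp add: o_def g)
    moreover have "distinct xs"
    proof -
      have "sorted_wrt (\<lambda>E F. Max E < Min F) Es" "\<forall>E\<in>set Es. finite E \<and> E \<noteq> {}"
        using adm by (auto simp: admissible_def)
      then show ?thesis unfolding xs_def
      proof (induction Es)
        case (Cons E Es)
        have "E \<inter> ?S \<noteq> F \<inter> ?S" if FE: "F \<in> set Es" "E \<inter> ?S \<noteq> {}" for F
        proof
          assume "E \<inter> ?S = F \<inter> ?S"
          then obtain j where j: "j \<in> E" "j \<in> F" using FE(2) by blast
          have "finite E" "finite F" "Max E < Min F" using Cons.prems FE(1) by auto
          then show False using j Max_ge Min_le by (meson leD order_trans)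
        qed
        then show ?case using Cons by auto
      qed simp
    qed
    moreover have "set xs \<subseteq> Pow ?S" by (auto simp: xs_def)
    ultimately show "(\<Sum>E\<leftarrow>Es. ?g E) \<in> (\<lambda>xs. \<Sum>E\<leftarrow>xs. ?g E) ` {xs. set xs \<subseteq> Pow ?S \<and> distinct xs}"
      by (intro image_eqI[of _ _ xs]) auto
  qed
  moreover have "finite {xs. set xs \<subseteq> Pow ?S \<and> distinct xs}"
    using assms by (intro finite_subset_distinct) simp
  ultimately show ?thesis by (meson finite_imageI finite_subset)
qed

lemma tnorm_level_mono: "tnorm_level k x \<le> tnorm_level (Suc k) x"
  by simp

lemma abs_le_tnorm_level: "fsupp x \<Longrightarrow> \<bar>x j\<bar> \<le> tnorm_level k x"
proof (induction k)
  case 0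
  then show ?case using finite_range_abs by (simp add: Max_ge)
next
  case (Suc k)
  then show ?case using tnorm_level_mono order_trans by blast
qed

lemma tnorm_level_le_l1: "fsupp x \<Longrightarrow> tnorm_level k x \<le> (\<Sum>j | x j \<noteq> 0. \<bar>x j\<bar>)"
proof (induction k arbitrary: x)
  case 0
  have "\<bar>x j\<bar> \<le> (\<Sum>j | x j \<noteq> 0. \<bar>x j\<bar>)" for j
    by (cases "x j = 0") (auto intro!: sum_nonneg member_le_sum simp: 0)
  then show ?case using finite_range_abs[OF 0] by auto
next
  case (Suc k)
  let ?S = "{j. x j \<noteq> 0}"
  have le: "tnorm_level k (restr E x) \<le> (\<Sum>j\<in>E \<inter> ?S. \<bar>x j\<bar>)" for E
  proof -
    have "{j. restr E x j \<noteq> 0} = E \<inter> ?S" by (auto simp: restr_def)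
    moreover have "(\<Sum>j\<in>E \<inter> ?S. \<bar>restr E x j\<bar>) = (\<Sum>j\<in>E \<inter> ?S. \<bar>x j\<bar>)"
      by (rule sum.cong) (auto simp: restr_def)
    ultimately show ?thesis using Suc.IH[OF fsupp_restr[OF Suc.prems], of E] by simp
  qed
  have bound: "(\<Sum>E\<leftarrow>Es. tnorm_level k (restr E x)) \<le> (\<Sum>j\<in>?S. \<bar>x j\<bar>)" if "admissible Es" for Es
  proof -
    have "sorted_wrt (\<lambda>E F. Max E < Min F) Es" "\<forall>E\<in>set Es. finite E \<and> E \<noteq> {}"
      using that by (auto simp: admissible_def)
    then have "(\<Sum>E\<leftarrow>Es. tnorm_level k (restr E x)) \<le> (\<Sum>j\<in>\<Union>(set Es) \<inter> ?S. \<bar>x j\<bar>)"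
    proof (induction Es)
      case (Cons E Es)
      have disj: "E \<inter> F = {}" if "F \<in> set Es" for F
      proof -
        have "finite E" "finite F" "Max E < Min F" using Cons.prems that by auto
        then show ?thesis using Max_ge Min_le by (meson disjoint_iff leD order_trans)
      qed
      have "(\<Sum>j\<in>\<Union>(set (E # Es)) \<inter> ?S. \<bar>x j\<bar>)
          = (\<Sum>j\<in>(E \<inter> ?S) \<union> (\<Union>(set Es) \<inter> ?S). \<bar>x j\<bar>)"
        by (rule sum.cong) auto
      also have "\<dots> = (\<Sum>j\<in>E \<inter> ?S. \<bar>x j\<bar>) + (\<Sum>j\<in>\<Union>(set Es) \<inter> ?S. \<bar>x j\<bar>)"
        by (rule sum.union_disjoint) (use Suc.prems disj in auto)
      finally show ?case using Cons le[of E] by simp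
    qed simp
    also have "\<dots> \<le> (\<Sum>j\<in>?S. \<bar>x j\<bar>)"
      by (rule sum_mono2) (use Suc.prems in auto)
    finally show ?thesis .
  qed
  then have "Max (tsum k x) \<le> (\<Sum>j\<in>?S. \<bar>x j\<bar>)"
    by (subst Max_le_iff[OF finite_tsum[OF Suc.prems] tsum_nonempty]) blast
  moreover have "0 \<le> (\<Sum>j\<in>?S. \<bar>x j\<bar>)" by (intro sum_nonneg) simp
  ultimately show ?case
    unfolding tnorm_level.simps using Suc.IH[OF Suc.prems] by (intro max.boundedI; linarith)
qed

lemma tnorm_level_tendsto:
  assumes "fsupp x"
  shows "(\<lambda>k. tnorm_level k x) \<longlonglongrightarrow> tnorm x"
proof -
  have "convergent (\<lambda>k. tnorm_level k x)"
  proof (rule Bseq_mono_convergent)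
    have "\<bar>tnorm_level k x\<bar> \<le> (\<Sum>j | x j \<noteq> 0. \<bar>x j\<bar>)" for k
      using tnorm_level_le_l1[OF assms, of k] abs_le_tnorm_level[OF assms, of 0 k] by linarith
    then show "Bseq (\<lambda>k. tnorm_level k x)" by (intro BseqI'[where K="\<Sum>j | x j \<noteq> 0. \<bar>x j\<bar>"]) simp
    show "\<forall>m n. m \<le> n \<longrightarrow> tnorm_level m x \<le> tnorm_level n x"
    proof (intro allI impI)
      fix m n :: nat assume "m \<le> n"
      then show "tnorm_level m x \<le> tnorm_level n x"
        by (rule lift_Suc_mono_le[rotated]) (rule tnorm_level_mono)
    qed
  qed
  then show ?thesis by (simp add: convergent_LIMSEQ_iff tnorm_def)
qed

lemma fsupp_add: "fsupp x \<Longrightarrow> fsupp y \<Longrightarrow> fsupp (\<lambda>j. x j + y j)"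
  by (rule finite_subset[of _ "{j. x j \<noteq> 0} \<union> {j. y j \<noteq> 0}"]) auto

lemma fsupp_scale: "fsupp x \<Longrightarrow> fsupp (\<lambda>j. a * x j)"
  by (erule rev_finite_subset) auto

lemma tnorm_level_add:
  "fsupp x \<Longrightarrow> fsupp y \<Longrightarrow> tnorm_level k (\<lambda>j. x j + y j) \<le> tnorm_level k x + tnorm_level k y"
proof (induction k arbitrary: x y)
  case 0
  have "\<bar>x j + y j\<bar> \<le> tnorm_level 0 x + tnorm_level 0 y" for j
    using abs_le_tnorm_level[OF 0(1), of j 0] abs_le_tnorm_level[OF 0(2), of j 0] by linarith
  then show ?case using finite_range_abs[OF fsupp_add[OF 0]] by (simp del: tnorm_level.simps add: tnorm_level.simps(1)[of "\<lambda>j. x j + y j"])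
next
  case (Suc k)
  have "(\<Sum>E\<leftarrow>Es. tnorm_level k (restr E (\<lambda>j. x j + y j))) \<le> Max (tsum k x) + Max (tsum k y)"
    if "admissible Es" for Es
  proof -
    have "restr E (\<lambda>j. x j + y j) = (\<lambda>j. restr E x j + restr E y j)" for E
      by (auto simp: restr_def)
    then have "(\<Sum>E\<leftarrow>Es. tnorm_level k (restr E (\<lambda>j. x j + y j)))
        \<le> (\<Sum>E\<leftarrow>Es. tnorm_level k (restr E x) + tnorm_level k (restr E y))"
      using Suc.IH[OF fsupp_restr[OF Suc.prems(1)] fsupp_restr[OF Suc.prems(2)]]
      by (intro sum_list_mono) simp
    also have "\<dots> = (\<Sum>E\<leftarrow>Es. tnorm_level k (restr E x)) + (\<Sum>E\<leftarrow>Es. tnorm_level k (restr E y))"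
      by (rule sum_list_addf)
    also have "\<dots> \<le> Max (tsum k x) + Max (tsum k y)"
      using that by (intro add_mono Max_ge finite_tsum Suc.prems) blast+
    finally show ?thesis .
  qed
  then have "Max (tsum k (\<lambda>j. x j + y j)) \<le> Max (tsum k x) + Max (tsum k y)"
    by (subst Max_le_iff[OF finite_tsum[OF fsupp_add[OF Suc.prems]] tsum_nonempty]) blast
  then show ?case
    unfolding tnorm_level.simps using Suc.IH[OF Suc.prems] by linarith
qed

lemma tnorm_level_scale_le:
  "fsupp x \<Longrightarrow> tnorm_level k (\<lambda>j. a * x j) \<le> \<bar>a\<bar> * tnorm_level k x"
proof (induction k arbitrary: x)
  case 0
  have "\<bar>a * x j\<bar> \<le> \<bar>a\<bar> * tnorm_level 0 x" for j
    using abs_le_tnorm_level[OF 0, of j 0] by (simp del: tnorm_level.simps add: abs_mult mult_left_mono)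
  then show ?case using finite_range_abs[OF fsupp_scale[OF 0]]
    by (simp del: tnorm_level.simps add: tnorm_level.simps(1)[of "\<lambda>j. a * x j"])
next
  case (Suc k)
  have "(\<Sum>E\<leftarrow>Es. tnorm_level k (restr E (\<lambda>j. a * x j))) \<le> \<bar>a\<bar> * Max (tsum k x)"
    if "admissible Es" for Es
  proof -
    have "restr E (\<lambda>j. a * x j) = (\<lambda>j. a * restr E x j)" for E
      by (auto simp: restr_def)
    then have "(\<Sum>E\<leftarrow>Es. tnorm_level k (restr E (\<lambda>j. a * x j)))
        \<le> (\<Sum>E\<leftarrow>Es. \<bar>a\<bar> * tnorm_level k (restr E x))"
      using Suc.IH[OF fsupp_restr[OF Suc.prems]] by (intro sum_list_mono) simp
    also have "\<dots> = \<bar>a\<bar> * (\<Sum>E\<leftarrow>Es. tnorm_level k (restr E x))"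
      by (rule sum_list_const_mult)
    also have "\<dots> \<le> \<bar>a\<bar> * Max (tsum k x)"
      using that by (intro mult_left_mono Max_ge finite_tsum Suc.prems) auto
    finally show ?thesis .
  qed
  then have m: "Max (tsum k (\<lambda>j. a * x j)) \<le> \<bar>a\<bar> * Max (tsum k x)"
    by (subst Max_le_iff[OF finite_tsum[OF fsupp_scale[OF Suc.prems]] tsum_nonempty]) blast
  have "\<bar>a\<bar> * tnorm_level k x \<le> \<bar>a\<bar> * tnorm_level (Suc k) x"
    by (intro mult_left_mono tnorm_level_mono) simp
  moreover have "\<bar>a\<bar> * (1/2 * Max (tsum k x)) \<le> \<bar>a\<bar> * tnorm_level (Suc k) x"
    by (intro mult_left_mono) simp_all
  ultimately show ?case using Suc.IH[OF Suc.prems] m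
    by (subst tnorm_level.simps) (simp del: tnorm_level.simps)
qed

lemma tnorm_add: "fsupp x \<Longrightarrow> fsupp y \<Longrightarrow> tnorm (\<lambda>j. x j + y j) \<le> tnorm x + tnorm y"
  by (rule LIMSEQ_le[OF tnorm_level_tendsto[OF fsupp_add]
        tendsto_add[OF tnorm_level_tendsto tnorm_level_tendsto]])
    (auto intro: tnorm_level_add)

lemma tnorm_scale_le: "fsupp x \<Longrightarrow> tnorm (\<lambda>j. a * x j) \<le> \<bar>a\<bar> * tnorm x"
  by (rule LIMSEQ_le[OF tnorm_level_tendsto[OF fsupp_scale]
        tendsto_mult[OF tendsto_const tnorm_level_tendsto]])
    (auto intro: tnorm_level_scale_le)

lemma tnorm_scale:
  assumes "fsupp x" shows "tnorm (\<lambda>j. a * x j) = \<bar>a\<bar> * tnorm x"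
proof (cases "a = 0")
  case True
  then show ?thesis by (simp add: tnorm_def tnorm_level_zero)
next
  case False
  have "tnorm x \<le> \<bar>inverse a\<bar> * tnorm (\<lambda>j. a * x j)"
    using tnorm_scale_le[OF fsupp_scale[OF assms], of "inverse a" a] False
    by (simp flip: mult.assoc)
  then have "\<bar>a\<bar> * tnorm x \<le> tnorm (\<lambda>j. a * x j)"
    using False by (simp add: field_simps abs_inverse)
  then show ?thesis using tnorm_scale_le[OF assms, of a] by simp
qed

lemma abs_le_tnorm: "fsupp x \<Longrightarrow> \<bar>x j\<bar> \<le> tnorm x"
  by (rule LIMSEQ_le_const[OF tnorm_level_tendsto]) (auto intro: abs_le_tnorm_level)

instantiation c00 :: real_normed_vector
begin

lift_definition zero_c00 :: c00 is "\<lambda>_. 0" by simp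

lift_definition plus_c00 :: "c00 \<Rightarrow> c00 \<Rightarrow> c00" is "\<lambda>x y j. x j + y j"
  by (simp add: fsupp_add)

lift_definition uminus_c00 :: "c00 \<Rightarrow> c00" is "\<lambda>x j. - x j" by simp

lift_definition minus_c00 :: "c00 \<Rightarrow> c00 \<Rightarrow> c00" is "\<lambda>x y j. x j - y j"
  subgoal for x y using fsupp_add[of x "\<lambda>j. - y j"] by simp
  done

lift_definition scaleR_c00 :: "real \<Rightarrow> c00 \<Rightarrow> c00" is "\<lambda>a x j. a * x j"
  by (simp add: fsupp_scale)

lift_definition norm_c00 :: "c00 \<Rightarrow> real" is tnorm .

definition dist_c00 :: "c00 \<Rightarrow> c00 \<Rightarrow> real" where
  "dist_c00 x y = norm (x - y)"

definition sgn_c00 :: "c00 \<Rightarrow> c00" where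
  "sgn_c00 x = scaleR (inverse (norm x)) x"

definition uniformity_c00 :: "(c00 \<times> c00) filter" where
  "uniformity_c00 = (INF e\<in>{0<..}. principal {(x, y). dist x y < e})"

definition open_c00 :: "c00 set \<Rightarrow> bool" where
  "open_c00 U \<longleftrightarrow> (\<forall>x\<in>U. \<forall>\<^sub>F (x', y) in uniformity. x' = x \<longrightarrow> y \<in> U)"

instance
proof
  fix x y z :: c00 and a b :: real and U :: "c00 set"
  show "x + y + z = x + (y + z)" "x + y = y + x" "0 + x = x" "- x + x = 0" "x - y = x + - y"
    by (transfer; simp add: algebra_simps)+
  show "a *\<^sub>R (x + y) = a *\<^sub>R x + a *\<^sub>R y" "(a + b) *\<^sub>R x = a *\<^sub>R x + b *\<^sub>R x"
    "a *\<^sub>R b *\<^sub>R x = (a * b) *\<^sub>R x" "1 *\<^sub>R x = x"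
    by (transfer; simp add: algebra_simps)+
  show "dist x y = norm (x - y)" by (rule dist_c00_def)
  show "sgn x = scaleR (inverse (norm x)) x" by (rule sgn_c00_def)
  show "uniformity = (INF e\<in>{0<..}. principal {(x :: c00, y). dist x y < e})"
    by (rule uniformity_c00_def)
  show "open U \<longleftrightarrow> (\<forall>x\<in>U. \<forall>\<^sub>F (x', y) in uniformity. x' = x \<longrightarrow> y \<in> U)"
    by (rule open_c00_def)
  show "norm x = 0 \<longleftrightarrow> x = 0"
  proof transfer
    fix x :: "nat \<Rightarrow> real" assume "x 0 = 0 \<and> fsupp x"
    then show "tnorm x = 0 \<longleftrightarrow> x = (\<lambda>_. 0)"
      using abs_le_tnorm[of x] by (auto simp: tnorm_def tnorm_level_zero)
  qed
  show "norm (x + y) \<le> norm x + norm y"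
    by transfer (simp add: tnorm_add)
  show "norm (a *\<^sub>R x) = \<bar>a\<bar> * norm x"
    by transfer (simp add: tnorm_scale)
qed

end

type_synonym tsirelson = "c00 ncompletion"

type_synonym tsirelson_dual = "tsirelson \<Rightarrow>\<^sub>L real"

text \<open>Indices into the increasing enumeration start at \<open>0\<close>, so $m_i$ is
  \<open>sorted_list_of_set m ! (i - 1)\<close>.\<close>

definition hamming_dist :: "nat \<Rightarrow> nat set \<Rightarrow> nat set \<Rightarrow> real" where
  "hamming_dist k m n =
     real (card {i. i < k \<and> sorted_list_of_set m ! i \<noteq> sorted_list_of_set n ! i})"

definition hamming_metric :: "nat \<Rightarrow> nat set metric" where
  "hamming_metric k = metric ([{1..}]\<^bsup>k\<^esup>, hamming_dist k)"

lemma Metric_space_hamming: "Metric_space ([{1..}]\<^bsup>k\<^esup>) (hamming_dist k)"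
proof
  fix x y z :: "nat set"
  show "0 \<le> hamming_dist k x y" by (simp add: hamming_dist_def)
  show "hamming_dist k x y = hamming_dist k y x" by (simp add: hamming_dist_def eq_commute)
  show "hamming_dist k x y = 0 \<longleftrightarrow> x = y" if "x \<in> [{1..}]\<^bsup>k\<^esup>" "y \<in> [{1..}]\<^bsup>k\<^esup>"
  proof -
    have f: "finite x" "finite y" "card x = k" "card y = k" using that by (auto simp: nsets_def)
    have "hamming_dist k x y = 0 \<longleftrightarrow> sorted_list_of_set x = sorted_list_of_set y"
      using f by (auto simp: hamming_dist_def list_eq_iff_nth_eq)
    then show ?thesis using f by (metis set_sorted_list_of_set)
  qed
  let ?D = "\<lambda>x y. {i. i < k \<and> sorted_list_of_set x ! i \<noteq> sorted_list_of_set y ! i}"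
  have "card (?D x z) \<le> card (?D x y \<union> ?D y z)"
    by (rule card_mono) auto
  also have "\<dots> \<le> card (?D x y) + card (?D y z)" by (rule card_Un_le)
  finally show "hamming_dist k x z \<le> hamming_dist k x y + hamming_dist k y z"
    by (simp add: hamming_dist_def)
qed

lemma mspace_hamming [simp]: "mspace (hamming_metric k) = [{1..}]\<^bsup>k\<^esup>"
  unfolding hamming_metric_def by (rule Metric_space.mspace_metric[OF Metric_space_hamming])

lemma mdist_hamming [simp]: "mdist (hamming_metric k) = hamming_dist k"
  unfolding hamming_metric_def by (rule Metric_space.mdist_metric[OF Metric_space_hamming])

definition Lip :: "'a metric \<Rightarrow> 'b metric \<Rightarrow> ('a \<Rightarrow> 'b) \<Rightarrow> real" where
  "Lip m1 m2 f = Inf {L. 0 \<le> L \<and>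
     (\<forall>x\<in>mspace m1. \<forall>y\<in>mspace m1. mdist m2 (f x) (f y) \<le> L * mdist m1 x y)}"

lemma Lip_least:
  assumes "Lipschitz_continuous_map m1 m2 f"
  shows "0 \<le> Lip m1 m2 f"
    and "x \<in> mspace m1 \<Longrightarrow> y \<in> mspace m1 \<Longrightarrow> mdist m2 (f x) (f y) \<le> Lip m1 m2 f * mdist m1 x y"
proof -
  let ?A = "{L. 0 \<le> L \<and>
     (\<forall>x\<in>mspace m1. \<forall>y\<in>mspace m1. mdist m2 (f x) (f y) \<le> L * mdist m1 x y)}"
  have ne: "?A \<noteq> {}"
    using assms unfolding Lipschitz_continuous_map_pos by (auto intro: less_imp_le)
  show "0 \<le> Lip m1 m2 f"
    unfolding Lip_def by (rule cInf_greatest[OF ne]) simp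
  assume xy: "x \<in> mspace m1" "y \<in> mspace m1"
  show "mdist m2 (f x) (f y) \<le> Lip m1 m2 f * mdist m1 x y"
  proof (cases "mdist m1 x y = 0")
    case True
    obtain L where "L \<in> ?A" using ne by blast
    then have "mdist m2 (f x) (f y) \<le> L * mdist m1 x y" using xy by simp
    with True show ?thesis by simp
  next
    case False
    then have pos: "mdist m1 x y > 0" using mdist_nonneg[of m1 x y] by linarith
    have "mdist m2 (f x) (f y) / mdist m1 x y \<le> Lip m1 m2 f"
      unfolding Lip_def by (rule cInf_greatest[OF ne]) (use xy pos in \<open>auto simp: field_simps\<close>)
    then show ?thesis using pos by (simp add: field_simps)
  qed
qed

end

theory Submission
  imports Defs
begin

text \<open>
  A functional on \<open>tsirelson\<close> is determined, with its norm, by its values on \<open>c00\<close>, so \<open>f\<close> may be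
  regarded as a map into the dual of \<open>c00\<close>. Write \<open>L\<close> for its Lipschitz constant.

  Letting the arguments of \<open>f\<close> tend to infinity one after the other, the largest first, along a free
  ultrafilter extends \<open>f\<close> from the \<open>k\<close>-element sets to the tree of all sets with at most \<open>k\<close>
  elements. The value at a set is the weak-star limit of the values at its children, and the
  Lipschitz condition bounds the increment from a parent to a child by \<open>L\<close>
  (\<open>weak_star_tree_exists\<close>). For \<open>s = {m_1 < ... < m_k}\<close> the difference between \<open>f s\<close> and the value
  at the root is the sum of the \<open>k\<close> increments along the branch of \<open>s\<close>.

  Two properties of Tsirelson's norm make this sum small. Tails of functionals vanish in norm
  (\<open>functional_tails_vanish\<close>), essentially because $\ell_1$ does not embed in the space; together
  with weak-star nullity of the increments this permits choosing an infinite set \<open>M\<close> sparse enough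
  that along all branches within \<open>M\<close> the increments are, up to an arbitrarily small error, carried by
  successive intervals (\<open>block_sequence\<close>). Functionals carried by \<open>k\<close> successive intervals that lie
  beyond \<open>k\<close> add up to at most twice their maximal norm (\<open>norm_sum_dual_blocks_le\<close>), which is the
  inequality defining the norm in dual form. Hence \<open>f\<close> maps the \<open>k\<close>-subsets of \<open>M\<close> into a ball
  around the root value of radius only slightly larger than \<open>2 L\<close>, and the diameter is at most
  \<open>5 L\<close>.
\<close>

section \<open>The limit norm and coordinate projections\<close>

lemma tnorm_level_restr_le:
  assumes "fsupp x" shows "tnorm_level k (restr E x) \<le> tnorm_level k x"
  using assms
proof (induction k arbitrary: x)
  case 0
  have "\<bar>restr E x j\<bar> \<le> tnorm_level 0 x" for j
    using abs_le_tnorm_level[OF 0, of j 0] by (auto simp: restr_def)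
  then show ?case
    by (subst tnorm_level.simps(1), subst Max_le_iff)
      (use finite_range_abs[OF fsupp_restr[OF 0]] in auto)
next
  case (Suc k)
  have "(\<Sum>F\<leftarrow>Es. tnorm_level k (restr F (restr E x))) \<le> Max (tsum k x)" if "admissible Es" for Es
  proof -
    have "restr F (restr E x) = restr E (restr F x)" for F by (auto simp: restr_def)
    then have "(\<Sum>F\<leftarrow>Es. tnorm_level k (restr F (restr E x))) \<le> (\<Sum>F\<leftarrow>Es. tnorm_level k (restr F x))"
      using Suc.IH[OF fsupp_restr[OF Suc.prems]] by (intro sum_list_mono) simp
    also have "\<dots> \<le> Max (tsum k x)"
      using that by (intro Max_ge finite_tsum Suc.prems) blast
    finally show ?thesis .
  qed
  then have "Max (tsum k (restr E x)) \<le> Max (tsum k x)"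
    by (subst Max_le_iff[OF finite_tsum[OF fsupp_restr[OF Suc.prems]] tsum_nonempty]) blast
  then show ?case unfolding tnorm_level.simps using Suc.IH[OF Suc.prems] by linarith
qed

lemma tnorm_restr_le: "fsupp x \<Longrightarrow> tnorm (restr E x) \<le> tnorm x"
  by (rule LIMSEQ_le[OF tnorm_level_tendsto[OF fsupp_restr] tnorm_level_tendsto])
    (auto intro: tnorm_level_restr_le)

lemma tnorm_level_le_tnorm: "fsupp x \<Longrightarrow> tnorm_level k x \<le> tnorm x"
proof (rule incseq_le[OF _ tnorm_level_tendsto])
  show "incseq (\<lambda>k. tnorm_level k x)" by (intro incseq_SucI tnorm_level_mono)
qed

text \<open>Members of an admissible list are pairwise different, so sums over the list may be taken over
  its set of members, which is what the counting arguments need.\<close>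

lemma admissible_distinct_sum:
  fixes g :: "nat set \<Rightarrow> real"
  assumes "admissible Es" shows "(\<Sum>E\<leftarrow>Es. g E) = (\<Sum>E\<in>set Es. g E)" "card (set Es) = length Es"
proof -
  have "sorted_wrt (\<lambda>E F. Max E < Min F) Es" "\<forall>E\<in>set Es. finite E \<and> E \<noteq> {}"
    using assms by (auto simp: admissible_def)
  then have "distinct Es"
  proof (induction Es)
    case (Cons E Es)
    have "E \<notin> set Es"
    proof
      assume "E \<in> set Es"
      then have "Max E < Min E" "finite E" "E \<noteq> {}" using Cons.prems by auto
      then show False using Min_le[OF _ Max_in, of E] by linarith
    qed
    then show ?case using Cons by simp
  qed simp
  then show "(\<Sum>E\<leftarrow>Es. g E) = (\<Sum>E\<in>set Es. g E)" "card (set Es) = length Es"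
    by (simp_all add: sum_list_distinct_conv_sum_set distinct_card)
qed

text \<open>Passing to the limit in the level norms turns their recursion into the implicit equation
  $\|x\| = \max(\max_j |x_j|, \frac12 \sup \sum_j \|E_j x\|)$. This lemma gives the lower
  bound for the norm that involves admissible families, the next one the upper bound.\<close>

lemma sum_tnorm_restr_le:
  assumes x: "fsupp x" and adm: "admissible Es"
  shows "(\<Sum>E\<in>set Es. tnorm (restr E x)) \<le> 2 * tnorm x"
proof -
  have "(\<Sum>E\<in>set Es. tnorm_level k (restr E x)) \<le> 2 * tnorm x" for k
  proof -
    have "(\<Sum>E\<in>set Es. tnorm_level k (restr E x)) \<le> Max (tsum k x)"
      using adm admissible_distinct_sum(1)[OF adm, symmetric]
      by (intro Max_ge finite_tsum x) blast
    also have "\<dots> \<le> 2 * tnorm_level (Suc k) x" by simp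
    also have "\<dots> \<le> 2 * tnorm x" using tnorm_level_le_tnorm[OF x, of "Suc k"] by linarith
    finally show ?thesis .
  qed
  moreover have "(\<lambda>k. \<Sum>E\<in>set Es. tnorm_level k (restr E x)) \<longlonglongrightarrow> (\<Sum>E\<in>set Es. tnorm (restr E x))"
    by (intro tendsto_sum tnorm_level_tendsto fsupp_restr x)
  ultimately show ?thesis by (intro LIMSEQ_le_const2) auto
qed

lemma tnorm_leI:
  assumes x: "fsupp x" and coord: "\<And>j. \<bar>x j\<bar> \<le> B"
    and sums: "\<And>Es. admissible Es \<Longrightarrow> (\<Sum>E\<in>set Es. tnorm (restr E x)) \<le> 2 * B"
  shows "tnorm x \<le> B"
proof -
  have "tnorm_level k x \<le> B" for k
  proof (induction k)
    case 0
    then show ?case using finite_range_abs[OF x] coord by simp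
  next
    case (Suc k)
    have "(\<Sum>E\<leftarrow>Es. tnorm_level k (restr E x)) \<le> 2 * B" if adm: "admissible Es" for Es
    proof -
      have "(\<Sum>E\<leftarrow>Es. tnorm_level k (restr E x)) \<le> (\<Sum>E\<in>set Es. tnorm (restr E x))"
        unfolding admissible_distinct_sum(1)[OF adm]
        by (intro sum_mono tnorm_level_le_tnorm fsupp_restr x)
      then show ?thesis using sums[OF adm] by linarith
    qed
    then have "Max (tsum k x) \<le> 2 * B"
      by (subst Max_le_iff[OF finite_tsum[OF x] tsum_nonempty]) blast
    then show ?case unfolding tnorm_level.simps using Suc.IH by simp
  qed
  then show ?thesis by (intro LIMSEQ_le_const2[OF tnorm_level_tendsto[OF x]]) blast
qed

lift_definition proj :: "nat set \<Rightarrow> c00 \<Rightarrow> c00" is restr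
  using fsupp_restr by (simp add: restr_def)

lemma norm_proj_le: "norm (proj E x) \<le> norm x"
  by transfer (simp add: tnorm_restr_le)

lemma proj_proj: "proj E (proj F x) = proj (E \<inter> F) x"
  by transfer (auto simp: restr_def)

lemma proj_add: "proj E (x + y) = proj E x + proj E y"
  by transfer (auto simp: restr_def)

lemma proj_scaleR: "proj E (a *\<^sub>R x) = a *\<^sub>R proj E x"
  by transfer (auto simp: restr_def)

lemma bounded_linear_proj: "bounded_linear (proj E)"
  by (rule bounded_linear_intro[where K=1]) (simp_all add: proj_add proj_scaleR norm_proj_le)

lemma proj_sum: "proj E (\<Sum>i\<in>I. g i) = (\<Sum>i\<in>I. proj E (g i))"
  by (rule linear_sum[OF bounded_linear.linear[OF bounded_linear_proj]])

lemma proj_empty [simp]: "proj {} x = 0"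
  by transfer (auto simp: restr_def)

lemma sum_norm_proj_le: "admissible Es \<Longrightarrow> (\<Sum>E\<in>set Es. norm (proj E x)) \<le> 2 * norm x"
  by transfer (simp add: sum_tnorm_restr_le)

lemma norm_c00_leI:
  assumes "\<And>j. \<bar>coord x j\<bar> \<le> B"
    and "\<And>Es. admissible Es \<Longrightarrow> (\<Sum>E\<in>set Es. norm (proj E x)) \<le> 2 * B"
  shows "norm x \<le> B"
  using assms by transfer (auto intro: tnorm_leI)

lemma abs_coord_le_norm: "\<bar>coord x j\<bar> \<le> norm x"
  by transfer (simp add: abs_le_tnorm)

lemma coord_add: "coord (x + y) j = coord x j + coord y j"
  by transfer simp

lemma coord_scaleR: "coord (a *\<^sub>R x) j = a * coord x j"
  by transfer simp

lemma coord_zero [simp]: "coord 0 j = 0"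
  by transfer simp

lemma coord_sum: "coord (\<Sum>i\<in>I. g i) j = (\<Sum>i\<in>I. coord (g i) j)"
  by (induction I rule: infinite_finite_induct) (simp_all add: coord_add)

lemma coord_proj: "coord (proj E x) j = (if j \<in> E then coord x j else 0)"
  by transfer (simp add: restr_def)

lemma c00_supported: "\<exists>p. \<forall>q\<ge>p. proj {..q} x = x"
proof transfer
  fix x :: "nat \<Rightarrow> real" assume "x 0 = 0 \<and> fsupp x"
  then have "finite {j. x j \<noteq> 0}" by simp
  then obtain p where "\<And>j. x j \<noteq> 0 \<Longrightarrow> j \<le> p" using finite_nat_set_iff_bounded_le by auto
  then show "\<exists>p. \<forall>q\<ge>p. restr {..q} x = x"
    by (intro exI[of _ p]) (auto simp: restr_def fun_eq_iff intro: le_trans)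
qed

section \<open>Tails of functionals\<close>

lemma admissible_separated:
  assumes "admissible Es" "E \<in> set Es" "F \<in> set Es" "E \<noteq> F"
  shows "Max E < Min F \<or> Max F < Min E"
proof -
  have "sorted_wrt (\<lambda>E F. Max E < Min F) Es" using assms by (simp add: admissible_def)
  then show ?thesis using assms(2-4) by (induction Es) auto
qed

lemma admissible_le_mem:
  assumes "admissible Es" "E \<in> set Es" "j \<in> E"
  shows "length Es \<le> j"
proof (cases Es)
  case (Cons F Fs)
  have fin: "finite G \<and> G \<noteq> {}" if "G \<in> set Es" for G using assms that by (auto simp: admissible_def)
  have "length Es \<le> Min F" "\<forall>G\<in>set Fs. Max F < Min G"
    using assms(1) unfolding Cons admissible_def sorted_wrt.simps list.sel by blast+
  moreover have "E = F \<or> E \<in> set Fs" using assms(2) Cons by simp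
  moreover have "Min F \<le> Max F" using fin[of F] Cons by simp
  moreover have "Min E \<le> j" using fin[OF assms(2)] assms(3) by simp
  ultimately show ?thesis by force
qed (use assms in \<open>auto simp: admissible_def\<close>)

text \<open>In general an admissible family can pick up norm \<open>2\<close> from a vector of norm \<open>1\<close>. If \<open>y\<close> lives on
  an interval in which no member of the family begins, then at most one member meets that interval,
  and the sum is at most \<open>1\<close>. The correction term therefore only counts members that begin in the
  interval, and over disjoint intervals these counts add up to at most the length of the family.\<close>

lemma sum_norm_proj_block_le:
  assumes adm: "admissible Es" and y: "norm y \<le> 1" "proj {a<..b} y = y"
  shows "(\<Sum>E\<in>set Es. norm (proj E y)) \<le> 1 + real (card {E \<in> set Es. Min E \<in> {a<..b}})"
proof (cases "{E \<in> set Es. Min E \<in> {a<..b}} = {}")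
  case False
  then have "card {E \<in> set Es. Min E \<in> {a<..b}} \<ge> 1"
    by (simp add: Suc_le_eq card_gt_0_iff)
  then show ?thesis using sum_norm_proj_le[OF adm, of y] y by linarith
next
  case True
  have meets: "\<exists>j\<in>E. j \<in> {a<..b}" if "proj E y \<noteq> 0" for E
  proof (rule ccontr)
    assume "\<not> ?thesis"
    then have "E \<inter> {a<..b} = {}" by blast
    then show False using that proj_proj[of E "{a<..b}" y] y(2) by simp
  qed
  have fin: "finite E" if "E \<in> set Es" for E
    using adm that by (simp add: admissible_def)
  have less: False if EF: "E \<in> set Es" "F \<in> set Es" "proj E y \<noteq> 0" "proj F y \<noteq> 0" "Max E < Min F" for E F
  proof -
    obtain i j where ij: "i \<in> E" "i \<in> {a<..b}" "j \<in> F" "j \<in> {a<..b}" using meets EF by metis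
    have "i \<le> Max E" "Min F \<le> j" using ij fin EF by auto
    then have "Min F \<in> {a<..b}" using ij EF by auto
    then show False using True EF by blast
  qed
  have uniq: "E = F" if "E \<in> set Es" "F \<in> set Es" "proj E y \<noteq> 0" "proj F y \<noteq> 0" for E F
    using admissible_separated[OF adm that(1,2)] less that by blast
  have "(\<Sum>E\<in>set Es. norm (proj E y)) \<le> 1"
  proof (cases "\<exists>E\<in>set Es. proj E y \<noteq> 0")
    case True
    then obtain F where F: "F \<in> set Es" "proj F y \<noteq> 0" by blast
    have "(\<Sum>E\<in>set Es. norm (proj E y)) = (\<Sum>E\<in>{F}. norm (proj E y))"
      using F uniq by (intro sum.mono_neutral_right) auto
    then show ?thesis using norm_proj_le[of F y] y by simp
  qed simp
  then show ?thesis by linarith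
qed

text \<open>This is where $\ell_1$ is excluded: the average of many blocks does not add a full unit to the
  norm of a vector that precedes them. An admissible family that sees \<open>x\<close> must start at or before
  \<open>p\<close>, so it has at most \<open>p\<close> members. These can split only \<open>p\<close> of the \<open>r\<close> blocks, and on the
  unsplit blocks the factor $\frac12$ is lost. The family thus contributes at most
  $1 + \frac12(1 + p/r) \le \frac74$, whereas a family starting beyond \<open>p\<close> sees the average alone.\<close>

lemma norm_block_average_le:
  assumes x: "proj {..p} x = x" "norm x \<le> 1"
    and q: "q 0 \<ge> p" "mono q"
    and y: "\<And>i. i < r \<Longrightarrow> norm (y i) \<le> 1" "\<And>i. i < r \<Longrightarrow> proj {q i<..q (Suc i)} (y i) = y i"
    and r: "r \<ge> 1" "r \<ge> 2 * p"
  shows "norm (x + (1 / real r) *\<^sub>R (\<Sum>i<r. y i)) \<le> 7/4"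
proof (rule norm_c00_leI)
  define av where "av = (1 / real r) *\<^sub>R (\<Sum>i<r. y i)"
  have r0: "real r > 0" using r by simp
  have qp: "p \<le> q i" for i using q monoD[OF q(2), of 0 i] by simp
  have y_proj: "proj E (y i) = 0" if "i < r" "E \<inter> {q i<..q (Suc i)} = {}" for E i
    using proj_proj[of E "{q i<..q (Suc i)}" "y i"] y(2)[OF that(1)] that(2) by simp
  have "norm (\<Sum>i<r. y i) \<le> real r"
    using sum_norm_le[of "{..<r}" y "\<lambda>_. 1"] y(1) by simp
  then have av1: "norm av \<le> 1" using r0 by (simp add: av_def field_simps)
  have av0: "proj {..p} av = 0"
  proof -
    have "proj {..p} (y i) = 0" if "i < r" for i
      by (rule y_proj[OF that]) (use qp[of i] in auto)
    then show ?thesis by (simp add: av_def proj_scaleR proj_sum)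
  qed
  have coord0: "coord x j = 0 \<or> coord av j = 0" for j
    using arg_cong[OF x(1), of "\<lambda>z. coord z j"] arg_cong[OF av0, of "\<lambda>z. coord z j"]
    by (auto simp: coord_proj split: if_splits)
  show "\<bar>coord (x + (1 / real r) *\<^sub>R (\<Sum>i<r. y i)) j\<bar> \<le> 7/4" for j
    unfolding av_def[symmetric] coord_add
    using abs_coord_le_norm[of x j] abs_coord_le_norm[of av j] coord0[of j] av1 x(2) by auto
  fix Es assume adm: "admissible Es"
  have fin: "finite E" if "E \<in> set Es" for E
    using adm that by (simp add: admissible_def)
  have "(\<Sum>E\<in>set Es. norm (proj E (x + av))) \<le> 2 * (7/4)"
  proof (cases "length Es > p")
    case True
    have "proj E x = 0" if "E \<in> set Es" for E
    proof -
      have "E \<inter> {..p} = {}" using admissible_le_mem[OF adm that] True by force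
      then show ?thesis using proj_proj[of E "{..p}" x] x(1) by simp
    qed
    then have "(\<Sum>E\<in>set Es. norm (proj E (x + av))) = (\<Sum>E\<in>set Es. norm (proj E av))"
      by (simp add: proj_add)
    also have "\<dots> \<le> 2" using sum_norm_proj_le[OF adm, of av] av1 by linarith
    finally show ?thesis by simp
  next
    case False
    define N where "N i = {E \<in> set Es. Min E \<in> {q i<..q (Suc i)}}" for i
    have disj: "N i \<inter> N j = {}" if "i \<noteq> j" for i j
    proof -
      have "{q i<..q (Suc i)} \<inter> {q j<..q (Suc j)} = {}"
        using that monoD[OF q(2), of "Suc i" j] monoD[OF q(2), of "Suc j" i]
        by (cases i j rule: linorder_cases) auto
      then show ?thesis by (auto simp: N_def)
    qed
    have "(\<Sum>i<r. card (N i)) = card (\<Union>i<r. N i)"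
      by (rule card_UN_disjoint[symmetric]) (use disj in \<open>auto simp: N_def\<close>)
    also have "\<dots> \<le> card (set Es)" by (rule card_mono) (auto simp: N_def)
    also have "\<dots> \<le> p" using False admissible_distinct_sum(2)[OF adm] by simp
    finally have N: "(\<Sum>i<r. real (card (N i))) \<le> real p"
      by (metis of_nat_mono of_nat_sum)
    have "(\<Sum>E\<in>set Es. norm (proj E av)) \<le> (\<Sum>E\<in>set Es. (1 / real r) * (\<Sum>i<r. norm (proj E (y i))))"
      by (intro sum_mono) (auto simp: av_def proj_scaleR proj_sum intro!: divide_right_mono norm_sum)
    also have "\<dots> = (1 / real r) * (\<Sum>i<r. \<Sum>E\<in>set Es. norm (proj E (y i)))"
      by (subst sum.swap) (simp add: sum_distrib_left)
    also have "\<dots> \<le> (1 / real r) * (\<Sum>i<r. 1 + real (card (N i)))"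
      unfolding N_def
      by (intro mult_left_mono sum_mono sum_norm_proj_block_le[OF adm] y) auto
    also have "\<dots> \<le> (1 / real r) * (real r + real p)"
      using N by (intro mult_left_mono) (auto simp: sum.distrib)
    also have "\<dots> \<le> 3/2" using r r0 by (simp add: field_simps)
    finally have "(\<Sum>E\<in>set Es. norm (proj E av)) \<le> 3/2" .
    moreover have "(\<Sum>E\<in>set Es. norm (proj E (x + av)))
        \<le> (\<Sum>E\<in>set Es. norm (proj E x)) + (\<Sum>E\<in>set Es. norm (proj E av))"
      unfolding sum.distrib[symmetric] by (intro sum_mono) (simp add: proj_add norm_triangle_ineq)
    ultimately show ?thesis using sum_norm_proj_le[OF adm, of x] x(2) by linarith
  qed
  then show "(\<Sum>E\<in>set Es. norm (proj E (x + (1 / real r) *\<^sub>R (\<Sum>i<r. y i)))) \<le> 2 * (7/4)"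
    by (simp add: av_def)
qed

definition Proj :: "nat set \<Rightarrow> c00 \<Rightarrow>\<^sub>L c00" where
  "Proj E = Blinfun (proj E)"

lemma Proj_apply [simp]: "blinfun_apply (Proj E) x = proj E x"
  by (simp add: Proj_def bounded_linear_Blinfun_apply bounded_linear_proj)

lemma norm_compose_Proj_le:
  fixes \<phi> :: "c00 \<Rightarrow>\<^sub>L real" shows "norm (\<phi> o\<^sub>L Proj E) \<le> norm \<phi>"
proof (rule norm_blinfun_bound)
  show "norm ((\<phi> o\<^sub>L Proj E) x) \<le> norm \<phi> * norm x" for x
    using norm_blinfun[of \<phi> "proj E x"] mult_left_mono[OF norm_proj_le[of E x] norm_ge_zero[of \<phi>]]
    by simp
qed simp

lemma norm_blinfun_less_witness:
  fixes \<phi> :: "'a::real_normed_vector \<Rightarrow>\<^sub>L real"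
  assumes "0 \<le> b" "b < norm \<phi>"
  shows "\<exists>x. norm x \<le> 1 \<and> \<phi> x > b"
proof (rule ccontr)
  assume no: "\<not> ?thesis"
  have "norm (\<phi> x) \<le> b * norm x" for x
  proof (cases "x = 0")
    case False
    define u where "u = (1 / norm x) *\<^sub>R x"
    have "norm u = 1" "norm (- u) = 1" using False by (simp_all add: u_def)
    then have "\<phi> u \<le> b" "\<phi> (- u) \<le> b" using no by (metis not_less order_refl)+
    then have "\<bar>\<phi> u\<bar> \<le> b" by (simp add: blinfun.minus_right)
    moreover have "\<phi> u = \<phi> x / norm x" by (simp add: u_def blinfun.scaleR_right)
    ultimately show ?thesis using False by (simp add: abs_divide field_simps)
  qed simp
  then have "norm \<phi> \<le> b" using assms(1) by (intro norm_blinfun_bound) auto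
  then show False using assms by simp
qed

text \<open>The tail
  norms decrease to some \<open>c\<close>. If \<open>c\<close> were positive, then beyond a point \<open>N\<close> where the tail norm is
  already close to \<open>c\<close> there would be successive blocks of norm at most \<open>1\<close> on each of which \<open>\<phi>\<close> is
  nearly \<open>c\<close>. On the first block plus a long average of later ones \<open>\<phi>\<close> would be nearly \<open>2 c\<close>, but
  such a vector has norm at most $\frac74$. It follows that the coordinate functionals span a
  norm-dense subspace of the dual.\<close>

lemma functional_tails_vanish:
  fixes \<phi> :: "c00 \<Rightarrow>\<^sub>L real"
  assumes "\<epsilon> > 0" shows "\<exists>p. \<forall>q\<ge>p. norm (\<phi> o\<^sub>L Proj {q<..}) \<le> \<epsilon>"
proof -
  define a where "a p = norm (\<phi> o\<^sub>L Proj {p<..})" for p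
  have dec: "a q \<le> a p" if "p \<le> q" for p q
  proof -
    have "\<phi> o\<^sub>L Proj {q<..} = (\<phi> o\<^sub>L Proj {p<..}) o\<^sub>L Proj {q<..}"
      using that by (intro blinfun_eqI) (simp add: proj_proj inf.absorb2 greaterThan_subset_iff)
    then show ?thesis unfolding a_def using norm_compose_Proj_le by metis
  qed
  define c where "c = (INF p. a p)"
  have bdd: "bdd_below (range a)" by (intro bdd_belowI[of _ 0]) (auto simp: a_def)
  have c_le: "c \<le> a p" for p unfolding c_def by (rule cINF_lower[OF bdd]) simp
  have near: "\<exists>p. a p < b" if "c < b" for b
    using that unfolding c_def by (subst (asm) cINF_less_iff[OF _ bdd]) auto
  have "c \<le> 0"
  proof (rule ccontr)
    assume "\<not> c \<le> 0"
    then have c: "c > 0" by simp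
    \<comment> \<open>The tolerances are chosen so that the two bounds conflict:
      $2\cdot\frac{15}{16} > \frac{17}{16}\cdot\frac74$.\<close>
    then obtain N where N: "a N < 17/16 * c" using near[of "17/16 * c"] by auto
    define good where "good q q' x \<longleftrightarrow> q < q' \<and> norm x \<le> 1 \<and> proj {q<..q'} x = x \<and> \<phi> x > 15/16 * c"
      for q q' :: nat and x
    have "\<exists>x q'. good q q' x" for q
    proof -
      have "15/16 * c < norm (\<phi> o\<^sub>L Proj {q<..})" using c_le[of q] c by (simp add: a_def)
      then obtain w where w: "norm w \<le> 1" "(\<phi> o\<^sub>L Proj {q<..}) w > 15/16 * c"
        using norm_blinfun_less_witness[of "15/16 * c" "\<phi> o\<^sub>L Proj {q<..}"] c by auto
      obtain p where p: "\<forall>q'\<ge>p. proj {..q'} w = w" using c00_supported by blast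
      define q' where "q' = max p (Suc q)"
      have "proj {q<..q'} w = proj {q<..} w"
      proof -
        have "{q<..q'} = {q<..} \<inter> {..q'}" by auto
        then show ?thesis using p by (simp add: q'_def flip: proj_proj)
      qed
      then have "good q q' (proj {q<..} w)"
        using w norm_proj_le[of "{q<..}" w] p
        by (auto simp: good_def q'_def proj_proj inf_commute Int_absorb1 greaterThanAtMost_def)
      then show ?thesis by blast
    qed
    then obtain X Q where XQ: "\<And>q. good q (Q q) (X q)" by metis
    define q where "q = rec_nat N (\<lambda>_. Q)"
    have q: "q 0 = N" "\<And>i. q (Suc i) = Q (q i)" by (simp_all add: q_def)
    define y where "y i = X (q i)" for i
    have y: "q i < q (Suc i)" "norm (y i) \<le> 1" "proj {q i<..q (Suc i)} (y i) = y i"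
      "\<phi> (y i) > 15/16 * c" for i
      using XQ[of "q i"] by (auto simp: good_def y_def q)
    have qN: "N \<le> q i" for i
      by (induction i) (use y(1) q(1) in \<open>auto intro: order_trans less_imp_le\<close>)
    \<comment> \<open>The first block ends at \<open>q 1\<close>, so this is the length required by the averaging estimate.\<close>
    define r where "r = 2 * q 1"
    have r: "r \<ge> 1" using y(1)[of 0] by (simp add: r_def)
    define z where "z = y 0 + (1 / real r) *\<^sub>R (\<Sum>i<r. y (Suc i))"
    have supp: "proj {..q 1} (y 0) = y 0"
      using proj_proj[of "{..q 1}" "{q 0<..q 1}" "y 0"] y(3)[of 0]
      by (simp add: inf.absorb2 greaterThanAtMost_subseteq_atLeastAtMost_iff greaterThanAtMost_def)
    have z_norm: "norm z \<le> 7/4"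
      unfolding z_def
      by (rule norm_block_average_le[where p="q 1" and q="\<lambda>i. q (Suc i)"])
        (use y supp r in \<open>auto simp: r_def mono_iff_le_Suc less_imp_le\<close>)
    have tail: "proj {N<..} (y i) = y i" for i
    proof -
      have "{N<..} \<inter> {q i<..q (Suc i)} = {q i<..q (Suc i)}" using qN[of i] by auto
      then show ?thesis using proj_proj[of "{N<..}" "{q i<..q (Suc i)}" "y i"] y(3)[of i] by simp
    qed
    have "proj {N<..} z = z" by (simp add: z_def proj_add proj_scaleR proj_sum tail)
    then have "\<phi> z = (\<phi> o\<^sub>L Proj {N<..}) z" by simp
    also have "\<dots> \<le> a N * norm z"
      using norm_blinfun[of "\<phi> o\<^sub>L Proj {N<..}" z] by (simp add: a_def)
    also have "\<dots> \<le> (17/16 * c) * (7/4)"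
      using N z_norm c by (intro mult_mono) auto
    finally have "\<phi> z \<le> 119/64 * c" by simp
    moreover have "\<phi> z \<ge> 15/16 * c + 15/16 * c"
    proof -
      have "real r * (15/16 * c) \<le> (\<Sum>i<r. \<phi> (y (Suc i)))"
        using sum_bounded_below[of "{..<r}" "15/16 * c" "\<lambda>i. \<phi> (y (Suc i))"] y(4)
        by (auto simp: less_imp_le)
      then have "15/16 * c \<le> (1 / real r) * (\<Sum>i<r. \<phi> (y (Suc i)))"
        using r by (simp add: field_simps)
      moreover have "\<phi> z = \<phi> (y 0) + (1 / real r) * (\<Sum>i<r. \<phi> (y (Suc i)))"
        by (simp add: z_def blinfun.add_right blinfun.scaleR_right blinfun.sum_right)
      ultimately show ?thesis using y(4)[of 0] by linarith
    qed
    ultimately show False using c by simp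
  qed
  then obtain p where "a p < \<epsilon>" using near[of \<epsilon>] assms by auto
  then show ?thesis using dec unfolding a_def by (meson less_imp_le order_trans)
qed

section \<open>Functionals with almost successive supports\<close>

text \<open>The coordinate \<open>0\<close> of a vector must vanish, so index \<open>0\<close> yields the zero vector.\<close>

definition unit_vec :: "nat \<Rightarrow> c00" where
  "unit_vec j = Abs_c00 (\<lambda>i. if i = j \<and> j \<noteq> 0 then 1 else 0)"

lemma coord_unit_vec: "coord (unit_vec j) i = (if i = j \<and> j \<noteq> 0 then 1 else 0)"
  unfolding unit_vec_def by (subst Abs_c00_inverse) auto

lemma proj_initial_expansion: "proj {..p} x = (\<Sum>j\<le>p. coord x j *\<^sub>R unit_vec j)"
proof -
  have c0: "coord x 0 = 0" using coord[of x] by simp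
  have "coord (proj {..p} x) i = coord (\<Sum>j\<le>p. coord x j *\<^sub>R unit_vec j) i" for i
  proof -
    have "coord (\<Sum>j\<le>p. coord x j *\<^sub>R unit_vec j) i
        = (\<Sum>j\<le>p. if i = j then coord x i else 0)"
      unfolding coord_sum coord_scaleR coord_unit_vec using c0 by (intro sum.cong) auto
    also have "\<dots> = coord (proj {..p} x) i" by (simp add: coord_proj)
    finally show ?thesis by simp
  qed
  then show ?thesis by (simp add: coord_inject[symmetric] fun_eq_iff)
qed

text \<open>On a fixed initial segment, pointwise convergence to zero controls the norm: only finitely many
  unit vectors are involved, and coordinates are bounded by the norm.\<close>

lemma norm_compose_initial_Proj_le:
  fixes \<phi> :: "c00 \<Rightarrow>\<^sub>L real"
  shows "norm (\<phi> o\<^sub>L Proj {..p}) \<le> (\<Sum>j\<le>p. \<bar>\<phi> (unit_vec j)\<bar>)"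
proof (rule norm_blinfun_bound)
  show "0 \<le> (\<Sum>j\<le>p. \<bar>\<phi> (unit_vec j)\<bar>)" by (intro sum_nonneg) simp
  fix x
  have "\<bar>\<phi> (proj {..p} x)\<bar> \<le> (\<Sum>j\<le>p. \<bar>coord x j * \<phi> (unit_vec j)\<bar>)"
    unfolding proj_initial_expansion by (simp add: blinfun.sum_right blinfun.scaleR_right)
  also have "\<dots> \<le> (\<Sum>j\<le>p. norm x * \<bar>\<phi> (unit_vec j)\<bar>)"
    by (intro sum_mono) (simp add: abs_mult mult_right_mono abs_coord_le_norm)
  finally show "norm ((\<phi> o\<^sub>L Proj {..p}) x) \<le> (\<Sum>j\<le>p. \<bar>\<phi> (unit_vec j)\<bar>) * norm x"
    by (simp add: sum_distrib_left mult.commute)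
qed

lemma compose_Proj_split:
  fixes \<phi> :: "c00 \<Rightarrow>\<^sub>L real"
  assumes "p \<le> q"
  shows "\<phi> - (\<phi> o\<^sub>L Proj {p<..q}) = (\<phi> o\<^sub>L Proj {..p}) + (\<phi> o\<^sub>L Proj {q<..})"
proof (rule blinfun_eqI)
  fix x
  have "x = proj {..p} x + proj {p<..q} x + proj {q<..} x"
  proof -
    have "coord x i = coord (proj {..p} x + proj {p<..q} x + proj {q<..} x) i" for i
      using assms by (auto simp: coord_add coord_proj)
    then show ?thesis by (simp add: coord_inject[symmetric] fun_eq_iff)
  qed
  from arg_cong[OF this, of \<phi>]
  show "(\<phi> - (\<phi> o\<^sub>L Proj {p<..q})) x = ((\<phi> o\<^sub>L Proj {..p}) + (\<phi> o\<^sub>L Proj {q<..})) x"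
    by (simp add: blinfun.add_right blinfun.add_left blinfun.diff_left)
qed

text \<open>The defining inequality of the norm, read in the dual: successive intervals that start late
  enough form an admissible family, hence \<open>k\<close> functionals carried by them add up to at most twice
  their largest norm, independently of \<open>k\<close>.\<close>

lemma norm_sum_dual_blocks_le:
  fixes \<psi> :: "nat \<Rightarrow> c00 \<Rightarrow>\<^sub>L real"
  assumes p: "strict_mono p" and I: "finite I" "card I \<le> p 0" and L: "L \<ge> 0" "\<And>t. t \<in> I \<Longrightarrow> norm (\<psi> t) \<le> L"
  shows "norm (\<Sum>t\<in>I. \<psi> t o\<^sub>L Proj {p t<..p (Suc t)}) \<le> 2 * L"
proof (cases "I = {}")
  case False
  define E where "E t = {p t<..p (Suc t)}" for t
  define Es where "Es = map E (sorted_list_of_set I)"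
  have pS: "p t < p (Suc t)" for t using p by (simp add: strict_mono_Suc_iff)
  have MinE: "Min (E t) = Suc (p t)" for t
    unfolding E_def using pS[of t] by (intro Min_eqI) auto
  have MaxE: "Max (E t) = p (Suc t)" for t
    unfolding E_def using pS[of t] by (intro Max_eqI) auto
  have sep: "Max (E s) < Min (E t)" if "s < t" for s t
    using that strict_mono_less_eq[OF p, of "Suc s" t] by (simp add: MinE MaxE)
  have inj: "inj_on E I"
    by (intro inj_onI) (metis MinE Suc_inject p strict_mono_eq)
  have setEs: "set Es = E ` I" using I by (simp add: Es_def)
  have adm: "admissible Es"
    unfolding admissible_def
  proof (intro conjI)
    show "Es \<noteq> []" using I False by (simp add: Es_def)
    show "\<forall>F\<in>set Es. finite F \<and> F \<noteq> {}" using pS by (auto simp: setEs E_def)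
    have "hd Es = E (hd (sorted_list_of_set I))" using I False by (simp add: Es_def hd_map)
    then have "p 0 \<le> Min (hd Es)"
      using strict_mono_less_eq[OF p, of 0 "hd (sorted_list_of_set I)"] by (simp add: MinE)
    then show "length Es \<le> Min (hd Es)" using I by (simp add: Es_def)
    show "sorted_wrt (\<lambda>E F. Max E < Min F) Es"
      unfolding Es_def sorted_wrt_map
      by (rule sorted_wrt_mono_rel[OF _ strict_sorted_list_of_set]) (use sep in blast)
  qed
  show ?thesis
  proof (rule norm_blinfun_bound)
    fix x
    have "\<bar>\<Sum>t\<in>I. \<psi> t (proj (E t) x)\<bar> \<le> (\<Sum>t\<in>I. \<bar>\<psi> t (proj (E t) x)\<bar>)" by (rule sum_abs)
    also have "\<dots> \<le> (\<Sum>t\<in>I. L * norm (proj (E t) x))"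
    proof (rule sum_mono)
      fix t assume "t \<in> I"
      have "\<bar>\<psi> t (proj (E t) x)\<bar> \<le> norm (\<psi> t) * norm (proj (E t) x)"
        using norm_blinfun[of "\<psi> t" "proj (E t) x"] by simp
      also have "\<dots> \<le> L * norm (proj (E t) x)" by (intro mult_right_mono L \<open>t \<in> I\<close>) simp
      finally show "\<bar>\<psi> t (proj (E t) x)\<bar> \<le> L * norm (proj (E t) x)" .
    qed
    also have "\<dots> = L * (\<Sum>F\<in>set Es. norm (proj F x))"
      unfolding setEs sum.reindex[OF inj] by (simp add: sum_distrib_left)
    also have "\<dots> \<le> L * (2 * norm x)" by (intro mult_left_mono sum_norm_proj_le adm L)
    finally show "norm ((\<Sum>t\<in>I. \<psi> t o\<^sub>L Proj {p t<..p (Suc t)}) x) \<le> 2 * L * norm x"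
      by (simp add: blinfun.sum_left E_def)
  qed (use L in simp)
qed (use L in simp)

section \<open>Weak-star limits along a free ultrafilter\<close>

text \<open>A filter that decides every predicate and contains all cofinite sets. Along it every bounded
  real sequence converges, so iterated limits exist without choosing subsequences.\<close>

definition free_ultrafilter :: "nat filter \<Rightarrow> bool" where
  "free_ultrafilter U \<longleftrightarrow> U \<noteq> bot \<and> U \<le> sequentially \<and>
     (\<forall>P. eventually P U \<or> eventually (\<lambda>n. \<not> P n) U)"

text \<open>Zorn's lemma, applied to the proper filters below \<open>sequentially\<close> with the reversed order.\<close>

lemma free_ultrafilter_exists: "\<exists>U. free_ultrafilter U"
proof -
  define A where "A = {F :: nat filter. F \<noteq> bot \<and> F \<le> sequentially}"
  have "\<exists>m\<in>A. \<forall>a\<in>A. m \<ge> a \<longrightarrow> a = m"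
  proof (rule predicate_Zorn)
    show "partial_order_on A (relation_of (\<ge>) A)"
      by (auto simp: partial_order_on_def preorder_on_def relation_of_def
          intro!: refl_onI transI antisymI)
    fix C assume "C \<in> Chains (relation_of (\<ge>) A)"
    then have sub: "C \<subseteq> A" and chain: "\<And>F G. F \<in> C \<Longrightarrow> G \<in> C \<Longrightarrow> F \<le> G \<or> G \<le> F"
      by (auto simp: Chains_def relation_of_def)
    show "\<exists>u\<in>A. \<forall>a\<in>C. a \<ge> u"
    proof (cases "C = {}")
      case True
      then show ?thesis by (auto simp: A_def intro!: exI[of _ sequentially])
    next
      case False
      have "\<not> eventually (\<lambda>_. False) (Inf C)"
      proof (subst eventually_Inf_base[OF False])
        show "\<exists>x\<in>C. x \<le> inf F G" if "F \<in> C" "G \<in> C" for F G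
          using chain[OF that] that by (auto simp: inf.absorb1 inf.absorb2)
        show "\<not> (\<exists>b\<in>C. \<forall>\<^sub>F _ in b. False)"
          using sub by (auto simp: A_def trivial_limit_def)
      qed
      moreover have "Inf C \<le> sequentially"
        using False sub by (auto simp: A_def intro: Inf_lower2)
      ultimately have "Inf C \<in> A" by (simp add: A_def trivial_limit_def)
      then show ?thesis by (auto intro!: bexI[of _ "Inf C"] Inf_lower)
    qed
  qed
  then obtain U where U: "U \<in> A" "\<And>F. F \<in> A \<Longrightarrow> F \<le> U \<Longrightarrow> F = U" by blast
  have "eventually P U \<or> eventually (\<lambda>n. \<not> P n) U" for P
  proof (cases "inf U (principal {n. P n}) = bot")
    case True
    then show ?thesis by (simp add: trivial_limit_def eventually_inf_principal)
  next
    case False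
    then have "inf U (principal {n. P n}) = U"
      using U by (auto simp: A_def intro: le_infI1)
    moreover have "eventually P (inf U (principal {n. P n}))"
      by (simp add: eventually_inf_principal)
    ultimately show ?thesis by simp
  qed
  then show ?thesis using U(1) by (auto simp: A_def free_ultrafilter_def)
qed

lemma free_ultrafilter_eventually_gt:
  assumes "free_ultrafilter U" shows "eventually (\<lambda>n. n > (b::nat)) U"
  using assms eventually_gt_at_top[of b] unfolding free_ultrafilter_def le_filter_def by blast

lemma free_ultrafilter_bounded_limit:
  fixes h :: "nat \<Rightarrow> real"
  assumes U: "free_ultrafilter U" and B: "eventually (\<lambda>n. \<bar>h n\<bar> \<le> B) U"
  shows "\<exists>l. (h \<longlongrightarrow> l) U"
proof -
  have nb: "filtermap h U \<noteq> bot"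
    using U by (simp add: free_ultrafilter_def filtermap_bot_iff)
  have "eventually (\<lambda>y. y \<in> {-B..B}) (filtermap h U)"
    using B by (auto simp: eventually_filtermap elim!: eventually_mono)
  then obtain l where l: "inf (nhds l) (filtermap h U) \<noteq> bot"
    using compact_Icc[of "-B" B] nb unfolding compact_filter by blast
  have "eventually (\<lambda>n. h n \<in> S) U" if S: "open S" "l \<in> S" for S
  proof (rule ccontr)
    assume "\<not> eventually (\<lambda>n. h n \<in> S) U"
    then have "eventually (\<lambda>n. h n \<notin> S) U"
      using U unfolding free_ultrafilter_def by blast
    then have "eventually (\<lambda>y. y \<notin> S) (filtermap h U)" by (simp add: eventually_filtermap)
    moreover have "eventually (\<lambda>y. y \<in> S) (nhds l)" using S by (rule eventually_nhds_in_open)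
    ultimately have "eventually (\<lambda>y. False) (inf (nhds l) (filtermap h U))"
      unfolding eventually_inf by blast
    then show False using l by (simp add: trivial_limit_def)
  qed
  then show ?thesis by (auto intro!: exI[of _ l] topological_tendstoI)
qed

lemma eventually_abs_apply_le:
  fixes g :: "'b \<Rightarrow> 'a::real_normed_vector \<Rightarrow>\<^sub>L real"
  assumes B: "eventually (\<lambda>n. norm (g n) \<le> B) F"
  shows "eventually (\<lambda>n. \<bar>g n x\<bar> \<le> B * norm x) F"
  using B
proof eventually_elim
  case (elim n)
  have "\<bar>g n x\<bar> \<le> norm (g n) * norm x" using norm_blinfun[of "g n" x] by simp
  also have "\<dots> \<le> B * norm x" by (intro mult_right_mono elim) simp
  finally show ?case .
qed

definition weak_star_lim ::
  "nat filter \<Rightarrow> (nat \<Rightarrow> 'a::real_normed_vector \<Rightarrow>\<^sub>L real) \<Rightarrow> 'a \<Rightarrow>\<^sub>L real" where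
  "weak_star_lim U g = (SOME \<phi> :: 'a \<Rightarrow>\<^sub>L real. \<forall>x. ((\<lambda>n. g n x) \<longlongrightarrow> \<phi> x) U)"

lemma weak_star_lim_tendsto:
  fixes g :: "nat \<Rightarrow> 'a::real_normed_vector \<Rightarrow>\<^sub>L real"
  assumes U: "free_ultrafilter U" and B: "eventually (\<lambda>n. norm (g n) \<le> B) U"
  shows "((\<lambda>n. g n x) \<longlongrightarrow> weak_star_lim U g x) U"
proof -
  have nb: "U \<noteq> bot" using U by (simp add: free_ultrafilter_def)
  have bd: "eventually (\<lambda>n. \<bar>g n x\<bar> \<le> B * norm x) U" for x
    by (rule eventually_abs_apply_le[OF B])
  obtain l where l: "\<And>x. ((\<lambda>n. g n x) \<longlongrightarrow> l x) U"
    using free_ultrafilter_bounded_limit[OF U bd] by metis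
  have "bounded_linear l"
  proof (rule bounded_linear_intro[where K=B])
    show "l (x + y) = l x + l y" for x y
      using tendsto_unique[OF nb l[of "x+y"]] tendsto_add[OF l[of x] l[of y]]
      by (simp add: blinfun.add_right)
    show "l (r *\<^sub>R x) = r *\<^sub>R l x" for r x
      using tendsto_unique[OF nb l[of "r *\<^sub>R x"]] tendsto_scaleR[OF tendsto_const l[of x]]
      by (simp add: blinfun.scaleR_right)
    show "norm (l x) \<le> norm x * B" for x
      using tendsto_upperbound[OF tendsto_rabs[OF l[of x]] bd nb] by (simp add: mult.commute)
  qed
  then have "\<forall>x. ((\<lambda>n. g n x) \<longlongrightarrow> Blinfun l x) U"
    using l by (simp add: bounded_linear_Blinfun_apply)
  then have "\<forall>x. ((\<lambda>n. g n x) \<longlongrightarrow> weak_star_lim U g x) U"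
    unfolding weak_star_lim_def by (rule someI)
  then show ?thesis by blast
qed

lemma norm_weak_star_limit_le:
  fixes g :: "'b \<Rightarrow> 'a::real_normed_vector \<Rightarrow>\<^sub>L real" and \<phi> :: "'a \<Rightarrow>\<^sub>L real"
  assumes "F \<noteq> bot" and l: "\<And>x. ((\<lambda>n. g n x) \<longlongrightarrow> \<phi> x) F"
    and B: "eventually (\<lambda>n. norm (g n) \<le> B) F"
  shows "norm \<phi> \<le> B"
proof (rule norm_blinfun_bound)
  have "\<exists>n. norm (g n) \<le> B" using B assms(1) eventually_happens by blast
  then show "0 \<le> B" using norm_ge_zero order_trans by blast
  fix x
  have "eventually (\<lambda>n. \<bar>g n x\<bar> \<le> B * norm x) F"
    by (rule eventually_abs_apply_le[OF B])
  then show "norm (\<phi> x) \<le> B * norm x"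
    using tendsto_upperbound[OF tendsto_rabs[OF l[of x]] _ assms(1)] by simp
qed

section \<open>Iterated limits of Lipschitz maps on the Hamming graph\<close>

lemma sorted_list_of_set_insert_greatest:
  assumes "finite s" "\<forall>j\<in>s. j < (q::nat)"
  shows "sorted_list_of_set (insert q s) = sorted_list_of_set s @ [q]"
proof -
  have "q \<notin> s" using assms by blast
  then show ?thesis using assms 
    by (simp add: sorted_insort_is_snoc order_less_imp_le)
qed

text \<open>Adding a new largest element appends one entry to the increasing enumeration, so it leaves the
  comparison of the earlier entries unchanged.\<close>

lemma hamming_dist_insert_greatest:
  assumes "s \<in> [{1..}]\<^bsup>i\<^esup>" "s' \<in> [{1..}]\<^bsup>i\<^esup>" "\<forall>j\<in>s. j < q" "\<forall>j\<in>s'. j < q'"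
  shows "hamming_dist (Suc i) (insert q s) (insert q' s') =
    hamming_dist i s s' + (if q = q' then 0 else 1)"
proof -
  have s: "finite s" "card s = i" "finite s'" "card s' = i" using assms by (auto simp: nsets_def)
  have "{j. j < Suc i \<and> sorted_list_of_set (insert q s) ! j \<noteq> sorted_list_of_set (insert q' s') ! j}
     = {j. j < i \<and> sorted_list_of_set s ! j \<noteq> sorted_list_of_set s' ! j} \<union> (if q = q' then {} else {i})"
    unfolding sorted_list_of_set_insert_greatest[OF s(1) assms(3)]
      sorted_list_of_set_insert_greatest[OF s(3) assms(4)]
    using s by (auto simp: nth_append less_Suc_eq)
  then show ?thesis unfolding hamming_dist_def by (simp split: if_splits)
qed

lemma hamming_dist_le: "hamming_dist k m n \<le> real k"
proof -
  have "card {i. i < k \<and> sorted_list_of_set m ! i \<noteq> sorted_list_of_set n ! i} \<le> card {..<k}"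
    by (rule card_mono) auto
  then show ?thesis by (simp add: hamming_dist_def)
qed

lemma insert_greatest_nsets:
  assumes "s \<in> [{1..}]\<^bsup>i\<^esup>" "\<forall>j\<in>s. j < q" "q \<ge> (1::nat)"
  shows "insert q s \<in> [{1..}]\<^bsup>Suc i\<^esup>"
proof -
  have "q \<notin> s" using assms by auto
  then show ?thesis using assms by (auto simp: nsets_def)
qed

text \<open>Each step removes the largest argument by letting it tend to infinity.\<close>

primrec iterated_lim ::
  "nat filter \<Rightarrow> (nat set \<Rightarrow> 'a::real_normed_vector \<Rightarrow>\<^sub>L real) \<Rightarrow> nat \<Rightarrow> nat set \<Rightarrow> 'a \<Rightarrow>\<^sub>L real" where
  "iterated_lim U f 0 s = f s"
| "iterated_lim U f (Suc j) s = weak_star_lim U (\<lambda>n. iterated_lim U f j (insert n s))"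

lemma free_ultrafilter_eventually_beyond:
  assumes U: "free_ultrafilter U" and "finite s"
  shows "eventually (\<lambda>n. n \<ge> 1 \<and> (\<forall>j\<in>s. j < n)) U"
proof -
  have "finite (insert 0 s)" using assms by simp
  from free_ultrafilter_eventually_gt[OF U, of "Max (insert 0 s)"] show ?thesis
    using assms(2) by (auto elim!: eventually_mono)
qed

text \<open>Appending the same large element to two sets does not change their Hamming distance, and norms
  are lower semicontinuous under pointwise limits; hence the bound and the Lipschitz constant pass
  from each level to the one below. The bound in turn is what makes the next limit exist, so all
  three claims are proved by a single induction.\<close>

lemma iterated_lim_lipschitz:
  fixes f :: "nat set \<Rightarrow> 'a::real_normed_vector \<Rightarrow>\<^sub>L real"
  assumes U: "free_ultrafilter U"
    and lip: "\<And>s s'. s \<in> [{1..}]\<^bsup>k\<^esup> \<Longrightarrow> s' \<in> [{1..}]\<^bsup>k\<^esup> \<Longrightarrow> norm (f s - f s') \<le> L * hamming_dist k s s'"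
    and bound: "\<And>s. s \<in> [{1..}]\<^bsup>k\<^esup> \<Longrightarrow> norm (f s) \<le> B"
    and "i + j = k" "s \<in> [{1..}]\<^bsup>i\<^esup>"
  shows "norm (iterated_lim U f j s) \<le> B"
    and "s' \<in> [{1..}]\<^bsup>i\<^esup> \<Longrightarrow>
      norm (iterated_lim U f j s - iterated_lim U f j s') \<le> L * hamming_dist i s s'"
    and "j = Suc j' \<Longrightarrow>
      ((\<lambda>n. iterated_lim U f j' (insert n s) x) \<longlongrightarrow> iterated_lim U f j s x) U"
proof -
  have nb: "U \<noteq> bot" using U by (simp add: free_ultrafilter_def)
  have "(\<forall>s\<in>[{1..}]\<^bsup>i\<^esup>. norm (iterated_lim U f j s) \<le> B) \<and>
    (\<forall>s\<in>[{1..}]\<^bsup>i\<^esup>. \<forall>s'\<in>[{1..}]\<^bsup>i\<^esup>.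
      norm (iterated_lim U f j s - iterated_lim U f j s') \<le> L * hamming_dist i s s') \<and>
    (\<forall>s\<in>[{1..}]\<^bsup>i\<^esup>. \<forall>j' x. j = Suc j' \<longrightarrow>
      ((\<lambda>n. iterated_lim U f j' (insert n s) x) \<longlongrightarrow> iterated_lim U f j s x) U)"
    using assms(4)
  proof (induction j arbitrary: i)
    case 0
    then show ?case using lip bound by simp
  next
    case (Suc j)
    have "Suc i + j = k" using Suc.prems by simp
    note IH = Suc.IH[OF this]
    note IH1 = bspec[OF IH[THEN conjunct1]]
      and IH2 = bspec[OF bspec[OF IH[THEN conjunct2, THEN conjunct1]]]
    have gr: "eventually (\<lambda>n. insert n s \<in> [{1..}]\<^bsup>Suc i\<^esup> \<and> (\<forall>j\<in>s. j < n)) U"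
      if s: "s \<in> [{1..}]\<^bsup>i\<^esup>" for s
    proof -
      have "finite s" using s by (simp add: nsets_def)
      from free_ultrafilter_eventually_beyond[OF U this] show ?thesis
        by eventually_elim (use insert_greatest_nsets[OF s] in blast)
    qed
    have bd: "eventually (\<lambda>n. norm (iterated_lim U f j (insert n s)) \<le> B) U"
      if s: "s \<in> [{1..}]\<^bsup>i\<^esup>" for s
      using gr[OF s] by eventually_elim (use IH1 in blast)
    have lims: "((\<lambda>n. iterated_lim U f j (insert n s) x) \<longlongrightarrow> iterated_lim U f (Suc j) s x) U"
      if s: "s \<in> [{1..}]\<^bsup>i\<^esup>" for s x
      using weak_star_lim_tendsto[OF U bd[OF s]] by simp
    have "norm (iterated_lim U f (Suc j) s) \<le> B" if s: "s \<in> [{1..}]\<^bsup>i\<^esup>" for s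
      by (rule norm_weak_star_limit_le[OF nb lims[OF s] bd[OF s]])
    moreover have "norm (iterated_lim U f (Suc j) s - iterated_lim U f (Suc j) s')
        \<le> L * hamming_dist i s s'"
      if s: "s \<in> [{1..}]\<^bsup>i\<^esup>" "s' \<in> [{1..}]\<^bsup>i\<^esup>" for s s'
    proof (rule norm_weak_star_limit_le[OF nb])
      show "((\<lambda>n. (iterated_lim U f j (insert n s) - iterated_lim U f j (insert n s')) x)
          \<longlongrightarrow> (iterated_lim U f (Suc j) s - iterated_lim U f (Suc j) s') x) U" for x
        using tendsto_diff[OF lims[OF s(1), of x] lims[OF s(2), of x]]
        by (simp add: blinfun.diff_left)
      show "\<forall>\<^sub>F n in U. norm (iterated_lim U f j (insert n s) - iterated_lim U f j (insert n s'))
          \<le> L * hamming_dist i s s'"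
        using gr[OF s(1)] gr[OF s(2)]
      proof eventually_elim
        case (elim n)
        then have "norm (iterated_lim U f j (insert n s) - iterated_lim U f j (insert n s'))
          \<le> L * hamming_dist (Suc i) (insert n s) (insert n s')"
          using IH2 by blast
        also have "\<dots> = L * hamming_dist i s s'"
          using hamming_dist_insert_greatest[OF s, of n n] elim by simp
        finally show ?case .
      qed
    qed
    moreover have "\<forall>j' x. Suc j = Suc j' \<longrightarrow>
        ((\<lambda>n. iterated_lim U f j' (insert n s) x) \<longlongrightarrow> iterated_lim U f (Suc j) s x) U"
      if s: "s \<in> [{1..}]\<^bsup>i\<^esup>" for s
      using lims[OF s] by (simp del: iterated_lim.simps)
    ultimately show ?case by (simp only: Ball_def) blast
  qed
  note claim = this
  show "norm (iterated_lim U f j s) \<le> B"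
    by (rule bspec[OF claim[THEN conjunct1] assms(5)])
  show "norm (iterated_lim U f j s - iterated_lim U f j s') \<le> L * hamming_dist i s s'"
    if "s' \<in> [{1..}]\<^bsup>i\<^esup>"
    by (rule bspec[OF bspec[OF claim[THEN conjunct2, THEN conjunct1] assms(5)] that])
  show "((\<lambda>n. iterated_lim U f j' (insert n s) x) \<longlongrightarrow> iterated_lim U f j s x) U" if "j = Suc j'"
    using bspec[OF claim[THEN conjunct2, THEN conjunct2] assms(5)] that by metis
qed

text \<open>Vertices of the tree are the sets with at most \<open>k\<close> elements, and the children of a vertex \<open>s\<close>
  arise by adding a new largest element. The increments along edges are bounded and, at each vertex,
  weak-star null along \<open>U\<close>.\<close>

definition weak_star_tree ::
  "nat filter \<Rightarrow> nat \<Rightarrow> real \<Rightarrow> (nat set \<Rightarrow> 'a::real_normed_vector \<Rightarrow>\<^sub>L real) \<Rightarrow> bool" where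
  "weak_star_tree U k L F \<longleftrightarrow> (\<forall>i<k. \<forall>s\<in>[{1..}]\<^bsup>i\<^esup>.
     (\<forall>n\<ge>1. (\<forall>j\<in>s. j < n) \<longrightarrow> norm (F (insert n s) - F s) \<le> L) \<and>
     (\<forall>x. ((\<lambda>n. F (insert n s) x) \<longlongrightarrow> F s x) U))"

lemma weak_star_treeD:
  assumes "weak_star_tree U k L F" "i < k" "s \<in> [{1..}]\<^bsup>i\<^esup>"
  shows "n \<ge> 1 \<Longrightarrow> \<forall>j\<in>s. j < n \<Longrightarrow> norm (F (insert n s) - F s) \<le> L"
    and "((\<lambda>n. F (insert n s) x) \<longlongrightarrow> F s x) U"
  using assms unfolding weak_star_tree_def by blast+

text \<open>Two siblings are at Hamming distance at most one, so their values differ by at most \<open>L\<close>. As a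
  parent is the limit of its children, the same bound holds for a child and its parent.\<close>

lemma weak_star_tree_exists:
  fixes f :: "nat set \<Rightarrow> 'a::real_normed_vector \<Rightarrow>\<^sub>L real"
  assumes U: "free_ultrafilter U" and L: "L \<ge> 0"
    and lip: "\<And>s s'. s \<in> [{1..}]\<^bsup>k\<^esup> \<Longrightarrow> s' \<in> [{1..}]\<^bsup>k\<^esup> \<Longrightarrow> norm (f s - f s') \<le> L * hamming_dist k s s'"
  shows "\<exists>F. weak_star_tree U k L F \<and> (\<forall>s\<in>[{1..}]\<^bsup>k\<^esup>. F s = f s)"
proof -
  have nb: "U \<noteq> bot" using U by (simp add: free_ultrafilter_def)
  define F where "F s = iterated_lim U f (k - card s) s" for s
  have F: "F s = iterated_lim U f (k - i) s" if "s \<in> [{1..}]\<^bsup>i\<^esup>" for i s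
    using that by (simp add: F_def nsets_def)
  have s0: "{1..k} \<in> [{1..}]\<^bsup>k\<^esup>" by (auto simp: nsets_def)
  have bound: "norm (f s) \<le> norm (f {1..k}) + L * k" if "s \<in> [{1..}]\<^bsup>k\<^esup>" for s
  proof -
    have "norm (f s - f {1..k}) \<le> L * hamming_dist k s {1..k}" by (rule lip[OF that s0])
    also have "\<dots> \<le> L * k" by (intro mult_left_mono hamming_dist_le L)
    finally show ?thesis using norm_triangle_sub[of "f s" "f {1..k}"] by linarith
  qed
  note lims = iterated_lim_lipschitz[OF U lip bound]
  have gr: "eventually (\<lambda>n. insert n s \<in> [{1..}]\<^bsup>Suc i\<^esup> \<and> n \<ge> 1 \<and> (\<forall>j\<in>s. j < n)) U"
    if s: "s \<in> [{1..}]\<^bsup>i\<^esup>" for s i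
  proof -
    have "finite s" using s by (simp add: nsets_def)
    from free_ultrafilter_eventually_beyond[OF U this] show ?thesis
      by eventually_elim (use insert_greatest_nsets[OF s] in blast)
  qed
  have tend: "((\<lambda>n. F (insert n s) x) \<longlongrightarrow> F s x) U" if i: "i < k" and s: "s \<in> [{1..}]\<^bsup>i\<^esup>" for i s x
  proof -
    have "((\<lambda>n. iterated_lim U f (k - Suc i) (insert n s) x) \<longlongrightarrow> iterated_lim U f (k - i) s x) U"
      by (rule lims(3)[of i "k - i"]) (use i s in auto)
    moreover have "eventually (\<lambda>n. iterated_lim U f (k - Suc i) (insert n s) x = F (insert n s) x) U"
      using gr[OF s]
    proof eventually_elim
      case (elim n)
      then show ?case using F[of "insert n s" "Suc i"] by simp
    qed
    ultimately show ?thesis unfolding F[OF s] by (rule Lim_transform_eventually)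
  qed
  have incr: "norm (F (insert n s) - F s) \<le> L"
    if i: "i < k" and s: "s \<in> [{1..}]\<^bsup>i\<^esup>" and n: "n \<ge> 1" "\<forall>j\<in>s. j < n" for i s n
  proof (rule norm_weak_star_limit_le[OF nb])
    show "((\<lambda>n'. (F (insert n s) - F (insert n' s)) x) \<longlongrightarrow> (F (insert n s) - F s) x) U" for x
      using tendsto_diff[OF tendsto_const tend[OF i s, of x]] by (simp add: blinfun.diff_left)
    have ins: "insert n s \<in> [{1..}]\<^bsup>Suc i\<^esup>" by (rule insert_greatest_nsets[OF s n(2,1)])
    show "\<forall>\<^sub>F n' in U. norm (F (insert n s) - F (insert n' s)) \<le> L"
      using gr[OF s]
    proof eventually_elim
      case (elim n')
      have "norm (F (insert n s) - F (insert n' s))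
          \<le> L * hamming_dist (Suc i) (insert n s) (insert n' s)"
        using lims(2)[of "Suc i" "k - Suc i" "insert n s" "insert n' s"] i elim ins
          F[OF ins] F[of "insert n' s" "Suc i"] by simp
      also have "hamming_dist (Suc i) (insert n s) (insert n' s) \<le> 1"
        using hamming_dist_insert_greatest[OF s s n(2), of n'] elim by (simp add: hamming_dist_def)
      finally show ?case using L by (simp add: mult_left_mono)
    qed
  qed
  have "weak_star_tree U k L F" using incr tend by (simp add: weak_star_tree_def)
  moreover have "F s = f s" if "s \<in> [{1..}]\<^bsup>k\<^esup>" for s using F[OF that] by simp
  ultimately show ?thesis by blast
qed

section \<open>Concentration\<close>

text \<open>For a new element \<open>m\<close> far out in the ultrafilter the increments at the finitely many sets
  \<open>s\<close> are small on \<open>{..p}\<close>, because they are weak-star null; once \<open>m\<close> is fixed, they are small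
  beyond some \<open>q\<close>, because tails of functionals vanish.\<close>

lemma next_block:
  fixes F :: "nat set \<Rightarrow> c00 \<Rightarrow>\<^sub>L real"
  assumes U: "free_ultrafilter U" and F: "weak_star_tree U k L F"
    and A: "finite A" "A \<subseteq> {1..}" and "\<epsilon> > 0"
  shows "\<exists>m q. m \<ge> 1 \<and> (\<forall>a\<in>A. a < m) \<and> p < q \<and> (\<forall>s\<subseteq>A. card s < k \<longrightarrow>
    norm (F (insert m s) - F s - ((F (insert m s) - F s) o\<^sub>L Proj {p<..q})) \<le> \<epsilon>)"
proof -
  define S where "S = {s. s \<subseteq> A \<and> card s < k}"
  have S: "finite S" using A by (simp add: S_def)
  have "eventually (\<lambda>n. (\<Sum>j\<le>p. \<bar>(F (insert n s) - F s) (unit_vec j)\<bar>) < \<epsilon> / 2) U" if "s \<in> S" for s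
  proof (rule order_tendstoD)
    have "s \<in> [{1..}]\<^bsup>card s\<^esup>" using that A by (auto simp: S_def nsets_def intro: finite_subset)
    then have "((\<lambda>n. F (insert n s) x) \<longlongrightarrow> F s x) U" for x
      using weak_star_treeD(2)[OF F, of "card s"] that by (simp add: S_def)
    then have "((\<lambda>n. \<Sum>j\<le>p. \<bar>F (insert n s) (unit_vec j) - F s (unit_vec j)\<bar>) \<longlongrightarrow>
        (\<Sum>j\<le>p. \<bar>F s (unit_vec j) - F s (unit_vec j)\<bar>)) U"
      by (intro tendsto_sum tendsto_rabs tendsto_diff tendsto_const)
    then show "((\<lambda>n. \<Sum>j\<le>p. \<bar>(F (insert n s) - F s) (unit_vec j)\<bar>) \<longlongrightarrow> 0) U"
      by (simp add: blinfun.diff_left)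
  qed (use \<open>\<epsilon> > 0\<close> in simp)
  then have "eventually (\<lambda>n. \<forall>s\<in>S. (\<Sum>j\<le>p. \<bar>(F (insert n s) - F s) (unit_vec j)\<bar>) < \<epsilon> / 2) U"
    by (intro eventually_ball_finite S) blast
  moreover have "eventually (\<lambda>n. n \<ge> 1 \<and> (\<forall>a\<in>A. a < n)) U" by (rule free_ultrafilter_eventually_beyond[OF U A(1)])
  moreover have "U \<noteq> bot" using U by (simp add: free_ultrafilter_def)
  ultimately obtain m where m: "m \<ge> 1" "\<forall>a\<in>A. a < m"
      "\<And>s. s \<in> S \<Longrightarrow> (\<Sum>j\<le>p. \<bar>(F (insert m s) - F s) (unit_vec j)\<bar>) < \<epsilon> / 2"
    using eventually_happens'[OF _ eventually_conj] by blast
  have "eventually (\<lambda>q. norm ((F (insert m s) - F s) o\<^sub>L Proj {q<..}) \<le> \<epsilon> / 2) sequentially" for s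
    unfolding eventually_sequentially by (rule functional_tails_vanish) (use \<open>\<epsilon> > 0\<close> in simp)
  then have "eventually (\<lambda>q. \<forall>s\<in>S. norm ((F (insert m s) - F s) o\<^sub>L Proj {q<..}) \<le> \<epsilon> / 2) sequentially"
    by (intro eventually_ball_finite S) blast
  from eventually_conj[OF this eventually_gt_at_top[of p]]
  obtain q where q: "p < q" "\<And>s. s \<in> S \<Longrightarrow> norm ((F (insert m s) - F s) o\<^sub>L Proj {q<..}) \<le> \<epsilon> / 2"
    using eventually_happens'[OF sequentially_bot] by blast
  have "norm (F (insert m s) - F s - ((F (insert m s) - F s) o\<^sub>L Proj {p<..q})) \<le> \<epsilon>" if "s \<in> S" for s
  proof -
    have "norm (F (insert m s) - F s - ((F (insert m s) - F s) o\<^sub>L Proj {p<..q}))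
        \<le> norm ((F (insert m s) - F s) o\<^sub>L Proj {..p}) + norm ((F (insert m s) - F s) o\<^sub>L Proj {q<..})"
      unfolding compose_Proj_split[OF less_imp_le[OF q(1)]] by (rule norm_triangle_ineq)
    then show ?thesis
      using norm_compose_initial_Proj_le[of "F (insert m s) - F s" p] m(3)[OF that] q(2)[OF that]
      by linarith
  qed
  then have "\<forall>s\<subseteq>A. card s < k \<longrightarrow>
      norm (F (insert m s) - F s - ((F (insert m s) - F s) o\<^sub>L Proj {p<..q})) \<le> \<epsilon>"
    by (simp add: S_def)
  then show ?thesis using m(1,2) q(1) by blast
qed

text \<open>Starting with \<open>p 0 = k\<close> puts all blocks beyond \<open>k\<close>, so that any \<open>k\<close> of them are
  admissible. The block of \<open>m t\<close> serves all sets \<open>s\<close> of earlier elements at once, because \<open>m t\<close> may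
  follow any of them in the enumeration of a set in the range of \<open>m\<close>.\<close>

lemma block_sequence:
  fixes F :: "nat set \<Rightarrow> c00 \<Rightarrow>\<^sub>L real"
  assumes U: "free_ultrafilter U" and F: "weak_star_tree U k L F"
    and \<epsilon>: "\<epsilon> > 0"
  obtains m p :: "nat \<Rightarrow> nat" where "strict_mono m" "strict_mono p" "p 0 = k" "\<And>t. m t \<ge> 1"
    "\<And>t s. s \<subseteq> m ` {..<t} \<Longrightarrow> card s < k \<Longrightarrow>
      norm (F (insert (m t) s) - F s - ((F (insert (m t) s) - F s) o\<^sub>L Proj {p t<..p (Suc t)})) \<le> \<epsilon>"
proof -
  define good where "good A p m q \<longleftrightarrow> m \<ge> 1 \<and> (\<forall>a\<in>A. a < m) \<and> p < q \<and> (\<forall>s\<subseteq>A. card s < k \<longrightarrow>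
    norm (F (insert m s) - F s - ((F (insert m s) - F s) o\<^sub>L Proj {p<..q})) \<le> \<epsilon>)" for A p m q
  have "\<exists>m q. good A p m q" if "finite A" "A \<subseteq> {1..}" for A p
    unfolding good_def by (rule next_block[OF U F that \<epsilon>])
  then obtain mm qq where mq: "\<And>A p. finite A \<Longrightarrow> A \<subseteq> {1..} \<Longrightarrow> good A p (mm A p) (qq A p)"
    by metis
  \<comment> \<open>A state consists of the set of elements chosen so far and the end of the last block.\<close>
  define st where "st = rec_nat ({}, k) (\<lambda>_ (A, p). (insert (mm A p) A, qq A p))"
  define m where "m t = mm (fst (st t)) (snd (st t))" for t
  define p where "p t = snd (st t)" for t
  have st: "fst (st 0) = {}" "p 0 = k" "fst (st (Suc t)) = insert (m t) (fst (st t))"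
    "p (Suc t) = qq (fst (st t)) (p t)" for t
    by (simp_all add: st_def m_def p_def split_beta)
  have "finite (fst (st t)) \<and> fst (st t) \<subseteq> {1..}" for t
  proof (induction t)
    case (Suc t)
    then show ?case using mq[of "fst (st t)" "snd (st t)"] by (simp add: st good_def m_def)
  qed (simp add: st)
  then have g: "good (fst (st t)) (p t) (m t) (p (Suc t))" for t
    using mq by (simp add: m_def st p_def[of t])
  have A: "fst (st t) = m ` {..<t}" for t
    by (induction t) (simp_all add: st lessThan_Suc)
  show thesis
  proof (rule that)
    show "strict_mono m"
      using g[of "Suc _"] unfolding strict_mono_Suc_iff by (simp add: good_def A)
    show "strict_mono p" using g by (simp add: strict_mono_Suc_iff good_def)
  qed (use g in \<open>auto simp: st good_def A\<close>)
qed

lemma telescope_over_initial_segments: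
  fixes F :: "'b set \<Rightarrow> 'a::ab_group_add" and I :: "'i::linorder set"
  assumes "finite I"
  shows "F (m ` I) - F {} =
    (\<Sum>t\<in>I. F (insert (m t) (m ` (I \<inter> {..<t}))) - F (m ` (I \<inter> {..<t})))"
  using assms
proof (induction I rule: finite_linorder_max_induct)
  case (insert b I)
  let ?D = "\<lambda>I t. F (insert (m t) (m ` (I \<inter> {..<t}))) - F (m ` (I \<inter> {..<t}))"
  have "b \<notin> I" using insert by blast
  have "insert b I \<inter> {..<b} = I" using insert by auto
  then have b: "?D (insert b I) b = F (m ` insert b I) - F (m ` I)" by simp
  have "insert b I \<inter> {..<t} = I \<inter> {..<t}" if "t \<in> I" for t
    using insert that by force
  then have "(\<Sum>t\<in>I. ?D (insert b I) t) = (\<Sum>t\<in>I. ?D I t)" by (intro sum.cong) auto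
  then have "(\<Sum>t\<in>insert b I. ?D (insert b I) t) = F (m ` insert b I) - F (m ` I) + (\<Sum>t\<in>I. ?D I t)"
    using insert \<open>b \<notin> I\<close> b by simp
  then show ?case by (simp flip: insert.IH)
qed simp

text \<open>Along an increasing enumeration of \<open>s\<close> the difference from the root value \<open>F {}\<close> is a sum of
  \<open>k\<close> increments of norm at most \<open>L\<close>. Up to \<open>\<epsilon>\<close> each is carried by its own block, so the sum has
  norm at most \<open>2 L\<close> up to the \<open>k\<close> errors.\<close>

lemma hamming_concentration_c00_dual:
  fixes f :: "nat set \<Rightarrow> c00 \<Rightarrow>\<^sub>L real"
  assumes L: "L \<ge> 0"
    and lip: "\<And>s s'. s \<in> [{1..}]\<^bsup>k\<^esup> \<Longrightarrow> s' \<in> [{1..}]\<^bsup>k\<^esup> \<Longrightarrow> norm (f s - f s') \<le> L * hamming_dist k s s'"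
    and \<epsilon>: "\<epsilon> > 0"
  shows "\<exists>M \<subseteq> {1..}. infinite M \<and> (\<exists>y. \<forall>s\<in>[M]\<^bsup>k\<^esup>. norm (f s - y) \<le> 2 * L + real k * \<epsilon>)"
proof -
  obtain U where U: "free_ultrafilter U" using free_ultrafilter_exists by blast
  have "\<exists>F. weak_star_tree U k L F \<and> (\<forall>s\<in>[{1..}]\<^bsup>k\<^esup>. F s = f s)"
    by (rule weak_star_tree_exists[OF U L lip])
  then obtain F where tree: "weak_star_tree U k L F" and F: "\<forall>s\<in>[{1..}]\<^bsup>k\<^esup>. F s = f s"
    by blast
  show ?thesis
  proof (rule block_sequence[OF U tree \<epsilon>])
    fix m p :: "nat \<Rightarrow> nat"
    assume m: "strict_mono m" "\<And>t. m t \<ge> 1" and p: "strict_mono p" "p 0 = k"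
      and block: "\<And>t s. s \<subseteq> m ` {..<t} \<Longrightarrow> card s < k \<Longrightarrow>
      norm (F (insert (m t) s) - F s - ((F (insert (m t) s) - F s) o\<^sub>L Proj {p t<..p (Suc t)})) \<le> \<epsilon>"
    have inj: "inj_on m J" for J using m(1) strict_mono_imp_inj_on inj_on_subset by blast
    have "norm (f s - F {}) \<le> 2 * L + real k * \<epsilon>" if s: "s \<in> [range m]\<^bsup>k\<^esup>" for s
    proof -
      have "s \<subseteq> range m" using s by (simp add: nsets_def)
      then obtain I where I: "s = m ` I" by (auto simp: subset_image_iff)
      have fin: "finite I" "card I = k"
        using s finite_image_iff[OF inj[of I]] card_image[OF inj[of I]] by (auto simp: I nsets_def)
      have s1: "s \<in> [{1..}]\<^bsup>k\<^esup>" using s m(2) by (auto simp: I nsets_def)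
      define J where "J t = m ` (I \<inter> {..<t})" for t
      define D where "D t = F (insert (m t) (J t)) - F (J t)" for t
      define P where "P t = D t o\<^sub>L Proj {p t<..p (Suc t)}" for t
      have cJ: "card (J t) < k" if "t \<in> I" for t
      proof -
        have "I \<inter> {..<t} \<subset> I" using that by auto
        then show ?thesis using psubset_card_mono[OF fin(1)] fin(2) by (simp add: J_def card_image[OF inj])
      qed
      have normD: "norm (D t) \<le> L" if "t \<in> I" for t
        unfolding D_def
      proof (rule weak_star_treeD(1)[OF tree cJ[OF that]])
        show "J t \<in> [{1..}]\<^bsup>card (J t)\<^esup>" using m(2) fin by (auto simp: J_def nsets_def)
        show "\<forall>j\<in>J t. j < m t" using strict_monoD[OF m(1)] by (auto simp: J_def)
      qed (rule m(2))
      have close: "norm (D t - P t) \<le> \<epsilon>" if "t \<in> I" for t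
        unfolding D_def P_def by (rule block[OF _ cJ[OF that]]) (auto simp: J_def)
      have "f s - F {} = (\<Sum>t\<in>I. D t)"
        using telescope_over_initial_segments[OF fin(1), of F m] F s1 by (simp add: D_def J_def I)
      also have "\<dots> = (\<Sum>t\<in>I. P t) + (\<Sum>t\<in>I. D t - P t)" by (simp add: sum_subtractf)
      finally have "norm (f s - F {}) \<le> norm (\<Sum>t\<in>I. P t) + norm (\<Sum>t\<in>I. D t - P t)"
        by (simp only: norm_triangle_ineq)
      moreover have "norm (\<Sum>t\<in>I. P t) \<le> 2 * L"
        unfolding P_def using p fin by (intro norm_sum_dual_blocks_le L normD) auto
      moreover have "norm (\<Sum>t\<in>I. D t - P t) \<le> real k * \<epsilon>"
        using sum_norm_le[of I "\<lambda>t. D t - P t" "\<lambda>_. \<epsilon>"] close fin by simp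
      ultimately show ?thesis by linarith
    qed
    moreover have "infinite (range m)" using finite_imageD[OF _ inj] by blast
    moreover have "range m \<subseteq> {1..}" using m(2) by auto
    ultimately show ?thesis by blast
  qed
qed

section \<open>Functionals on the completion\<close>

definition restrict_functional :: "tsirelson_dual \<Rightarrow> c00 \<Rightarrow>\<^sub>L real" where
  "restrict_functional \<phi> = \<phi> o\<^sub>L Blinfun ncompletion_of"

lemma restrict_functional_apply: "restrict_functional \<phi> x = \<phi> (ncompletion_of x)"
proof -
  have "bounded_linear (ncompletion_of :: c00 \<Rightarrow> tsirelson)"
    using ncompletion_of_linear
    by (auto simp: bounded_linear_def bounded_linear_axioms_def intro!: exI[of _ 1])
  then show ?thesis by (simp add: restrict_functional_def bounded_linear_Blinfun_apply)
qed

text \<open>The image of \<open>c00\<close> is dense, so no norm is lost.\<close>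

lemma norm_restrict_functional: "norm (restrict_functional \<phi>) = norm \<phi>"
proof (rule antisym)
  show "norm (restrict_functional \<phi>) \<le> norm \<phi>"
    by (rule norm_blinfun_bound)
      (use norm_blinfun[of \<phi> "ncompletion_of _"] in \<open>simp_all add: restrict_functional_apply\<close>)
  show "norm \<phi> \<le> norm (restrict_functional \<phi>)"
  proof (rule norm_blinfun_bound)
    fix z
    let ?C = "{z. norm (\<phi> z) \<le> norm (restrict_functional \<phi>) * norm z}"
    have "closed ?C" by (intro closed_Collect_le continuous_intros)
    moreover have "range ncompletion_of \<subseteq> ?C"
      using norm_blinfun[of "restrict_functional \<phi>"] by (auto simp: restrict_functional_apply)
    ultimately have "closure (range ncompletion_of) \<subseteq> ?C" by (intro closure_minimal)
    then show "norm (\<phi> z) \<le> norm (restrict_functional \<phi>) * norm z"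
      unfolding ncompletion_dense by blast
  qed simp
qed

lemma restrict_functional_diff:
  "restrict_functional (\<phi> - \<psi>) = restrict_functional \<phi> - restrict_functional \<psi>"
  by (rule blinfun_eqI) (simp add: restrict_functional_apply blinfun.diff_left)

theorem theoremD:
  fixes k :: nat and f :: "nat set \<Rightarrow> tsirelson_dual"
  assumes "k \<ge> 1"
    and "Lipschitz_continuous_map (hamming_metric k) euclidean_metric f"
  shows "\<exists>M \<subseteq> {1..}. infinite M \<and>
    (\<forall>m\<in>[M]\<^bsup>k\<^esup>. \<forall>n\<in>[M]\<^bsup>k\<^esup>.
       norm (f m - f n) \<le> 5 * Lip (hamming_metric k) euclidean_metric f)"
proof -
  define L where "L = Lip (hamming_metric k) euclidean_metric f"
  define g where "g s = restrict_functional (f s)" for s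
  have g_diff: "norm (g s - g s') = norm (f s - f s')" for s s'
    by (simp add: g_def norm_restrict_functional flip: restrict_functional_diff)
  have L0: "L \<ge> 0" unfolding L_def by (rule Lip_least(1)[OF assms(2)])
  have lip: "norm (g s - g s') \<le> L * hamming_dist k s s'"
    if "s \<in> [{1..}]\<^bsup>k\<^esup>" "s' \<in> [{1..}]\<^bsup>k\<^esup>" for s s'
    using Lip_least(2)[OF assms(2), of s s'] that by (simp add: g_diff L_def dist_norm)
  show ?thesis
  proof (cases "L = 0")
    case True
    have "norm (f m - f n) \<le> 5 * L" if "m \<in> [{1..}]\<^bsup>k\<^esup>" "n \<in> [{1..}]\<^bsup>k\<^esup>" for m n
      using lip[OF that] True by (simp add: g_diff)
    then show ?thesis unfolding L_def
      using infinite_Ici[of "1::nat"] by blast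
  next
    case False
    \<comment> \<open>With this error the diameter is at most \<open>2 (2 L + L / 4)\<close>, which leaves room below \<open>5 L\<close>.\<close>
    then have pos: "L / (4 * real k) > 0" using L0 assms(1) by simp
    have "\<exists>M \<subseteq> {1..}. infinite M \<and>
        (\<exists>y. \<forall>s\<in>[M]\<^bsup>k\<^esup>. norm (g s - y) \<le> 2 * L + real k * (L / (4 * real k)))"
      by (rule hamming_concentration_c00_dual[OF L0 lip pos])
    then obtain M y where M: "M \<subseteq> {1..}" "infinite M"
      and y: "\<forall>s\<in>[M]\<^bsup>k\<^esup>. norm (g s - y) \<le> 2 * L + real k * (L / (4 * real k))"
      by blast
    have "norm (f m - f n) \<le> 5 * L" if "m \<in> [M]\<^bsup>k\<^esup>" "n \<in> [M]\<^bsup>k\<^esup>" for m n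
    proof -
      have "norm (f m - f n) \<le> norm (g m - y) + norm (g n - y)"
        using norm_triangle_ineq4[of "g m - y" "g n - y"] by (simp add: g_diff)
      also have "\<dots> \<le> 5 * L" using bspec[OF y that(1)] bspec[OF y that(2)] L0 assms(1) by simp
      finally show ?thesis .
    qed
    then show ?thesis using M unfolding L_def by blast
  qed
qed

end
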